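(* Fix an integer $k\ge 0$. The number $b_{n,k}$ of connected chord diagrams $C$ with $n$ chords such that $b(C)\ge n-k$ satisfies, as $n\to\infty$, \[b_{n,k}\sim \frac{1}{\sqrt{\pi}\,2^{k+1}\,k!}\,\frac{(\ln n)^k\,2^n\,n!}{n^{3/2}}.\]
   Context: A chord diagram with $n$ chords is a perfect matching of $\{1,\dots,2n\}$; each pair $\{a,b\}$ with $a<b$ is a chord. The root chord is the chord containing $1$. The oriented intersection graph has a vertex per chord and an edge from $\{a,b\}$ to $\{c,d\}$ whenever $a<c<b<d$. The diagram is connected if this graph is connected (as an undirected graph); a chord is terminal if its vertex has no outgoing edge. The intersection order of the chords of a connected diagram $C$ is defined recursively: the root chord is first; removing the root chord leaves connected components $C_1,\dots,C_s$ (each regarded as a connected chord diagram, endpoints relabeled order-preservingly) ordered by their smallest endpoint; then come all chords of $C_1$ in their intersection order, then those of $C_2$, etc. $b(C)$ is the index in intersection order of the first terminal chord of $C$. *)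

theory Defs
  imports Complex_Main "HOL-Library.Landau_Symbols" "HOL-Library.Disjoint_Sets"
begin

text \<open>
  Chords are two-element sets of natural numbers; the endpoints of a chord \<open>c\<close> are
  \<open>Min c < Max c\<close>.
\<close>

definition chord_diagram :: "nat \<Rightarrow> nat set set \<Rightarrow> bool" where
  "chord_diagram n C \<longleftrightarrow> partition_on {1..2 * n} C \<and> (\<forall>c\<in>C. card c = 2)"

text \<open>
  A chord diagram whose endpoints form an arbitrary finite set of naturals. The components left
  after deleting a chord are kept in this form instead of being relabelled to \<open>{1..2 * m}\<close>: all
  the notions below depend on the relative order of the endpoints only.
\<close>

definition chord_set :: "nat set set \<Rightarrow> bool" where
  "chord_set C \<longleftrightarrow> finite C \<and> disjoint C \<and> (\<forall>c\<in>C. card c = 2)"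

definition root_chord :: "nat set set \<Rightarrow> nat set" where
  "root_chord C = (THE c. c \<in> C \<and> Min (\<Union>C) \<in> c)"

definition intersection_edges :: "nat set set \<Rightarrow> (nat set \<times> nat set) set" where
  "intersection_edges C =
     {(c, d). c \<in> C \<and> d \<in> C \<and> Min c < Min d \<and> Min d < Max c \<and> Max c < Max d}"

definition terminal_chord :: "nat set set \<Rightarrow> nat set \<Rightarrow> bool" where
  "terminal_chord C c \<longleftrightarrow> c \<in> C \<and> (\<nexists>d. (c, d) \<in> intersection_edges C)"

definition linked :: "nat set set \<Rightarrow> (nat set \<times> nat set) set" where
  "linked C = {(c, d). c \<in> C \<and> d \<in> C \<and>
     (c, d) \<in> (intersection_edges C \<union> (intersection_edges C)\<inverse>)\<^sup>*}"

definition connected_diagram :: "nat set set \<Rightarrow> bool" where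
  "connected_diagram C \<longleftrightarrow> C \<noteq> {} \<and> (\<forall>c\<in>C. \<forall>d\<in>C. (c, d) \<in> linked C)"

definition components_of :: "nat set set \<Rightarrow> nat set set set" where
  "components_of C = C // linked C"

definition sorted_components :: "nat set set \<Rightarrow> nat set set list" where
  "sorted_components C = sorted_key_list_of_set (\<lambda>D. Min (\<Union>D)) (components_of C)"

lemma equiv_linked: "equiv C (linked C)"
proof (rule equivI)
  show "linked C \<subseteq> C \<times> C" "refl_on C (linked C)"
    by (auto simp: linked_def refl_on_def)
  have "sym ((intersection_edges C \<union> (intersection_edges C)\<inverse>)\<^sup>*)"
    by (rule sym_rtrancl) (auto simp: sym_def)
  then show "sym (linked C)" by (auto simp: linked_def sym_def)
  show "trans (linked C)"
    by (auto simp: linked_def intro!: transI elim: rtrancl_trans)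
qed

lemma components_of_subset: "D \<in> components_of C \<Longrightarrow> D \<subseteq> C"
  by (auto simp: components_of_def quotient_def linked_def)

lemma components_of_nonempty: "D \<in> components_of C \<Longrightarrow> D \<noteq> {}"
  unfolding components_of_def by (rule in_quotient_imp_non_empty[OF equiv_linked])

lemma finite_components_of: "finite C \<Longrightarrow> finite (components_of C)"
  by (rule finite_subset[of _ "Pow C"]) (auto dest: components_of_subset)

lemma chord_set_mono: "chord_set C \<Longrightarrow> D \<subseteq> C \<Longrightarrow> chord_set D"
  by (auto simp: chord_set_def disjoint_def intro: finite_subset)

lemma chord_set_finite_Union: "chord_set C \<Longrightarrow> finite (\<Union>C)"
  unfolding chord_set_def by (rule finite_Union) (auto intro: card_ge_0_finite)

lemma chord_set_Min_in:
  assumes "chord_set C" "C \<noteq> {}"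
  shows "Min (\<Union>C) \<in> \<Union>C"
proof (rule Min_in)
  show "finite (\<Union>C)" by (rule chord_set_finite_Union[OF assms(1)])
  show "\<Union>C \<noteq> {}"
  proof -
    obtain c where "c \<in> C" using assms(2) by blast
    then have "c \<noteq> {}" using assms(1) by (auto simp: chord_set_def)
    then show ?thesis using \<open>c \<in> C\<close> by blast
  qed
qed

lemma root_chord_in:
  assumes "chord_set C" "C \<noteq> {}"
  shows "root_chord C \<in> C" "Min (\<Union>C) \<in> root_chord C"
proof -
  have "\<exists>!c. c \<in> C \<and> Min (\<Union>C) \<in> c"
    using chord_set_Min_in[OF assms] assms(1) unfolding chord_set_def disjoint_def by blast
  from theI'[OF this] show "root_chord C \<in> C" "Min (\<Union>C) \<in> root_chord C"
    by (auto simp: root_chord_def)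
qed

lemma chord_diagram_imp_chord_set: "chord_diagram n C \<Longrightarrow> chord_set C"
  by (auto simp: chord_diagram_def chord_set_def partition_on_def intro: finite_UnionD)

lemma chord_diagram_root_chord:
  assumes "chord_diagram n C" "n > 0"
  shows "root_chord C \<in> C" "1 \<in> root_chord C"
proof -
  have U: "\<Union>C = {1..2 * n}"
    using assms by (auto simp: chord_diagram_def partition_on_def)
  have M: "Min (\<Union>C) = 1"
    unfolding U using assms by (intro Min_eqI) auto
  have "C \<noteq> {}" using U assms by auto
  from root_chord_in[OF chord_diagram_imp_chord_set[OF assms(1)] this]
  show "root_chord C \<in> C" "1 \<in> root_chord C" by (simp_all add: M)
qed

lemma inj_on_Min_components:
  assumes "chord_set C"
  shows "inj_on (\<lambda>D. Min (\<Union>D)) (components_of C)"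
proof (rule inj_onI)
  fix D E assume D: "D \<in> components_of C" and E: "E \<in> components_of C"
    and eq: "Min (\<Union>D) = Min (\<Union>E)"
  have in_Un: "Min (\<Union>X) \<in> \<Union>X" if "X \<in> components_of C" for X
    by (rule chord_set_Min_in[OF chord_set_mono[OF assms components_of_subset[OF that]]
      components_of_nonempty[OF that]])
  obtain c d where c: "c \<in> D" "Min (\<Union>D) \<in> c" and d: "d \<in> E" "Min (\<Union>D) \<in> d"
    using in_Un[OF D] in_Un[OF E] eq by auto
  have "c = d"
    using c d assms components_of_subset[OF D] components_of_subset[OF E]
    unfolding chord_set_def disjoint_def by blast
  then show "D = E"
    using quotient_disj[OF equiv_linked[of C], of D E] D E c d
    by (auto simp: components_of_def)
qed

lemma
  assumes "chord_set C"
  shows set_sorted_components: "set (sorted_components C) = components_of C"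
    and sorted_sorted_components: "sorted (map (\<lambda>D. Min (\<Union>D)) (sorted_components C))"
    and distinct_sorted_components: "distinct (sorted_components C)"
proof -
  have "linorder.insort_key (\<le>) f x xs = insort_key f x xs"
    for f :: "nat set set \<Rightarrow> nat" and x xs
    by (induction xs) (simp_all add: linorder.insort_key.simps[OF linorder_class.linorder_axioms])
  then have "linorder.insort_key (\<le>) = (insort_key :: (nat set set \<Rightarrow> nat) \<Rightarrow> _)"
    by (intro ext)
  then have eq: "linorder.sorted_key_list_of_set (\<le>) f = sorted_key_list_of_set f"
    for f :: "nat set set \<Rightarrow> nat"
    by (simp add: linorder.sorted_key_list_of_set_def[OF linorder_class.linorder_axioms]
      sorted_key_list_of_set_def)
  interpret folding_insort_key "(\<le>)" "(<)" "components_of C" "\<lambda>D. Min (\<Union>D)"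
    by standard (rule inj_on_Min_components[OF assms])
  have fin: "finite (components_of C)"
    using assms by (auto simp: chord_set_def intro: finite_components_of)
  show "set (sorted_components C) = components_of C"
    "sorted (map (\<lambda>D. Min (\<Union>D)) (sorted_components C))"
    "distinct (sorted_components C)"
    using fin set_sorted_key_list_of_set[OF subset_refl] sorted_sorted_key_list_of_set[OF subset_refl]
      distinct_sorted_key_list_of_set[OF subset_refl]
    by (simp_all add: sorted_components_def eq distinct_map)
qed

text \<open>
  The test \<open>chord_set C \<and> C \<noteq> {}\<close> only serves to make the recursion total.
\<close>

function intersection_order :: "nat set set \<Rightarrow> nat set list" where
  "intersection_order C =
     (if chord_set C \<and> C \<noteq> {}
      then root_chord C #
        concat (map intersection_order (sorted_components (C - {root_chord C})))
      else [])"
  by auto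
termination
proof (relation "measure card", goal_cases)
  case 1
  show ?case by simp
next
  case (2 C D)
  then have C: "chord_set C" "C \<noteq> {}" by auto
  then have "D \<subseteq> C - {root_chord C}"
    using 2 set_sorted_components[OF chord_set_mono[OF C(1) Diff_subset]]
    by (auto dest: components_of_subset)
  then have "D \<subset> C" using root_chord_in(1)[OF C] by blast
  then show ?case using C by (simp add: chord_set_def psubset_card_mono)
qed

declare intersection_order.simps [simp del]

lemma set_intersection_order: "chord_set C \<Longrightarrow> set (intersection_order C) = C"
proof (induction C rule: intersection_order.induct)
  case (1 C)
  show ?case
  proof (cases "C = {}")
    case True
    then show ?thesis by (subst intersection_order.simps) simp
  next
    case False
    let ?C = "C - {root_chord C}"
    have cs: "chord_set ?C" by (rule chord_set_mono[OF "1.prems"]) auto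
    note ss = set_sorted_components[OF cs]
    have IH: "set (intersection_order D) = D" if "D \<in> components_of ?C" for D
    proof (rule "1.IH")
      show "chord_set C \<and> C \<noteq> {}" using "1.prems" False by simp
      show "D \<in> set (sorted_components ?C)" using that ss by simp
      show "chord_set D" by (rule chord_set_mono[OF cs components_of_subset[OF that]])
    qed
    have "intersection_order C =
        root_chord C # concat (map intersection_order (sorted_components ?C))"
      using "1.prems" False by (subst intersection_order.simps) simp
    then have "set (intersection_order C) =
        insert (root_chord C) (\<Union>D\<in>components_of ?C. set (intersection_order D))"
      by (simp add: ss)
    also have "\<dots> = insert (root_chord C) (\<Union>(components_of ?C))"
      using IH by simp
    also have "\<Union>(components_of ?C) = ?C"
      unfolding components_of_def by (rule Union_quotient[OF equiv_linked])
    also have "insert (root_chord C) ?C = C"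
      using root_chord_in(1)[OF "1.prems" False] by blast
    finally show ?thesis .
  qed
qed

text \<open>Positions in the intersection order are counted from 1, positions in a list from 0.\<close>

definition first_terminal_index :: "nat set set \<Rightarrow> nat" where
  "first_terminal_index C =
     (LEAST i. 1 \<le> i \<and> i \<le> length (intersection_order C) \<and>
        terminal_chord C (intersection_order C ! (i - 1)))"

definition num_diagrams :: "nat \<Rightarrow> nat \<Rightarrow> nat" where
  "num_diagrams n k =
     card {C. chord_diagram n C \<and> connected_diagram C \<and>
              int (first_terminal_index C) \<ge> int n - int k}"

end

theory Submission
  imports Defs "HOL-Analysis.Gamma_Function" "HOL-Real_Asymp.Real_Asymp"
begin

text \<open>
  Let \<open>C\<close> be connected with \<open>n \<ge> 2\<close> chords and let \<open>F\<close> be the first component left after deleting the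
  root. The root is not terminal, and a chord of \<open>F\<close> is terminal in \<open>C\<close> iff it is terminal in \<open>F\<close>, so
  \<open>b(C) = b(F) + 1\<close>. The right endpoint of the root and all other components lie in a single gap
  between two consecutive endpoints of \<open>F\<close>, so if \<open>F\<close> has \<open>m\<close> chords, \<open>C\<close> amounts to a choice of
  \<open>F\<close>, one of its \<open>2 m - 1\<close> gaps, and the connected diagram formed by the other \<open>n - m\<close> chords.
  Since \<open>b(F) \<le> m\<close>, only \<open>m = n - 1 - j\<close> with \<open>j \<le> k\<close> contributes to \<open>b(C) \<ge> n - k\<close>; writing \<open>c i\<close> for the
  number of connected diagrams with \<open>i\<close> chords, for \<open>n \<ge> k + 2\<close>
  \<open>b(n,k) = (\<Sum>j\<le>k. (2 n - 3 - 2 j) * c (j + 1) * b(n - 1 - j, k - j))\<close>.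
  For \<open>k = 0\<close> this gives \<open>(2 n - 3)!!\<close>. After division by \<open>(2 n - 3)!!\<close> the increments in \<open>n\<close> are dominated
  by the term \<open>j = 1\<close>, and Stolz--Cesaro yields \<open>(ln n)^k / (2^k k!)\<close> by induction on \<open>k\<close>.
\<close>

section \<open>Crossing chords and connectedness\<close>

text \<open>The undirected edge relation, stated without an ambient diagram so that it means the
  same in a diagram and in each of its subsets.\<close>

definition crosses :: "nat set \<Rightarrow> nat set \<Rightarrow> bool" where
  "crosses c d \<longleftrightarrow> Min c < Min d \<and> Min d < Max c \<and> Max c < Max d
    \<or> Min d < Min c \<and> Min c < Max d \<and> Max d < Max c"

lemma crosses_sym: "crosses c d \<Longrightarrow> crosses d c"
  by (auto simp: crosses_def)

lemma intersection_edges_Un_converse: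
  "intersection_edges C \<union> (intersection_edges C)\<inverse> = {(c, d). c \<in> C \<and> d \<in> C \<and> crosses c d}"
  by (auto simp: intersection_edges_def crosses_def)

lemma linked_crosses:
  "linked C = {(c, d). c \<in> C \<and> d \<in> C \<and> (c, d) \<in> {(c, d). c \<in> C \<and> d \<in> C \<and> crosses c d}\<^sup>*}"
  by (simp add: linked_def intersection_edges_Un_converse)

lemma linked_closed:
  assumes "(c, d) \<in> linked C" "c \<in> X"
    and closed: "\<And>x y. x \<in> X \<Longrightarrow> y \<in> C \<Longrightarrow> crosses x y \<Longrightarrow> y \<in> X"
  shows "d \<in> X"
proof -
  have "(c, d) \<in> {(c, d). c \<in> C \<and> d \<in> C \<and> crosses c d}\<^sup>*"
    using assms(1) by (simp add: linked_crosses)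
  then show ?thesis
    by induction (use assms(2) closed in auto)
qed

lemma linked_step: "(c, d) \<in> linked C \<Longrightarrow> e \<in> C \<Longrightarrow> crosses d e \<Longrightarrow> (c, e) \<in> linked C"
  unfolding linked_crosses by (auto intro: rtrancl_into_rtrancl)

lemma linked_mono: "X \<subseteq> C \<Longrightarrow> linked X \<subseteq> linked C"
  unfolding linked_crosses
  by (auto elim!: rev_subsetD[OF _ rtrancl_mono] subsetD[OF rtrancl_mono, rotated])

lemma linked_refl: "c \<in> C \<Longrightarrow> (c, c) \<in> linked C"
  by (simp add: linked_def)

text \<open>Connectedness as a cut criterion: a walk along crossings cannot leave a set that no
  crossing leaves. Together with \<open>connected_diagramI\<close> it replaces paths in most later
  arguments.\<close>

lemma connected_diagramD:
  assumes "connected_diagram C" "X \<subseteq> C" "X \<noteq> {}"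
    and "\<And>x y. x \<in> X \<Longrightarrow> y \<in> C - X \<Longrightarrow> \<not> crosses x y"
  shows "X = C"
proof -
  obtain x where x: "x \<in> X" using assms(3) by blast
  have "d \<in> X" if "d \<in> C" for d
  proof (rule linked_closed[of x d C])
    show "(x, d) \<in> linked C"
      using assms(1,2) x that by (auto simp: connected_diagram_def)
    show "x \<in> X" by (rule x)
  qed (use assms(4) in blast)
  then show ?thesis using assms(2) by blast
qed

lemma connected_diagramI:
  assumes "r \<in> C"
    and "\<And>X. X \<subseteq> C \<Longrightarrow> r \<in> X \<Longrightarrow> (\<And>x y. x \<in> X \<Longrightarrow> y \<in> C - X \<Longrightarrow> \<not> crosses x y) \<Longrightarrow> X = C"
  shows "connected_diagram C"
proof -
  \<comment> \<open>The hypothesis is applied to the class of \<open>r\<close>, which no crossing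
    leaves; any two chords are then linked through \<open>r\<close>.\<close>
  have "linked C `` {r} = C"
    by (rule assms(2)) (use assms(1) in \<open>auto simp: linked_refl dest: linked_step, auto simp: linked_def\<close>)
  then have r: "(r, c) \<in> linked C" if "c \<in> C" for c
    using that by blast
  then show ?thesis
    using assms(1) equiv_linked[of C] unfolding connected_diagram_def
    by (blast elim: equivE dest: symD transD)
qed

section \<open>Endpoints of chords and the root chord\<close>

lemma chord_obtain:
  assumes "chord_set C" "c \<in> C"
  obtains x y where "c = {x, y}" "x < y" "Min c = x" "Max c = y"
proof -
  have "card c = 2" using assms by (simp add: chord_set_def)
  then obtain x y where xy: "c = {x, y}" "x \<noteq> y" by (auto simp: card_2_iff)
  show ?thesis
  proof (cases "x < y")
    case True
    then show ?thesis using that[of x y] xy by simp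
  next
    case False
    then show ?thesis using that[of y x] xy by (simp add: insert_commute)
  qed
qed

lemma chord_Min_Max:
  assumes "chord_set C" "c \<in> C"
  shows "c = {Min c, Max c}" "Min c < Max c"
  using chord_obtain[OF assms] by metis+

lemma chord_set_eq: "chord_set C \<Longrightarrow> c \<in> C \<Longrightarrow> d \<in> C \<Longrightarrow> x \<in> c \<Longrightarrow> x \<in> d \<Longrightarrow> c = d"
  by (auto simp: chord_set_def disjoint_def)

lemma root_chord_eqI:
  assumes "chord_set C" "c \<in> C" "Min (\<Union>C) \<in> c"
  shows "root_chord C = c"
  using assms root_chord_in[OF assms(1)] chord_set_eq by blast

lemma Min_root_chord:
  assumes "chord_set C" "C \<noteq> {}"
  shows "Min (root_chord C) = Min (\<Union>C)"
proof (rule Min_eqI)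
  note r = root_chord_in[OF assms]
  have fin: "finite (\<Union>C)" by (rule chord_set_finite_Union[OF assms(1)])
  have sub: "root_chord C \<subseteq> \<Union>C" using r by blast
  then show "finite (root_chord C)" using fin by (rule finite_subset)
  show "Min (\<Union>C) \<in> root_chord C" by (rule r)
  show "Min (\<Union>C) \<le> y" if "y \<in> root_chord C" for y
    using fin sub that by (auto intro: Min_le)
qed

lemma card_Union_chord_set: "chord_set C \<Longrightarrow> card (\<Union>C) = 2 * card C"
  unfolding chord_set_def
  by (subst card_Union_disjoint) (auto intro: card_ge_0_finite)

lemma chord_diagram_iff: "chord_diagram n C \<longleftrightarrow> chord_set C \<and> \<Union>C = {1..2 * n}"
  using chord_diagram_imp_chord_set[of n C]
  by (auto simp: chord_diagram_def partition_on_def chord_set_def)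

section \<open>The first component and the first terminal chord\<close>

text \<open>Defined as the class of the root of the remaining chords, which is easier to handle than
  the head of \<open>sorted_components\<close>; \<open>sorted_components_Cons\<close> shows that the
  two agree.\<close>

definition first_component :: "nat set set \<Rightarrow> nat set set" where
  "first_component C = linked (C - {root_chord C}) `` {root_chord (C - {root_chord C})}"

lemma linked_class_eqI:
  assumes "X \<subseteq> C" "connected_diagram X" "r \<in> X"
    and "\<And>x y. x \<in> X \<Longrightarrow> y \<in> C - X \<Longrightarrow> \<not> crosses x y"
  shows "linked C `` {r} = X"
proof
  show "linked C `` {r} \<subseteq> X"
    using linked_closed[of r _ C X] assms(3,4) by blast
  show "X \<subseteq> linked C `` {r}"
    using assms(2,3) linked_mono[OF assms(1)] by (auto simp: connected_diagram_def)
qed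

lemma connected_linked_class:
  assumes "r \<in> C"
  shows "connected_diagram (linked C `` {r})"
proof (rule connected_diagramI)
  show "r \<in> linked C `` {r}" using assms by (simp add: linked_refl)
  fix X assume X: "X \<subseteq> linked C `` {r}" "r \<in> X"
    and cl: "\<And>x y. x \<in> X \<Longrightarrow> y \<in> linked C `` {r} - X \<Longrightarrow> \<not> crosses x y"
  have "linked C `` {r} \<subseteq> X"
  proof
    fix d assume "d \<in> linked C `` {r}"
    then have "(r, d) \<in> linked C" by simp
    then show "d \<in> X"
    proof (rule linked_closed[OF _ X(2)])
      fix x y assume "x \<in> X" "y \<in> C" "crosses x y"
      moreover from this have "y \<in> linked C `` {r}"
        using X(1) linked_step[of r x C y] by blast
      ultimately show "y \<in> X" using cl by blast
    qed
  qed
  then show "X = linked C `` {r}" using X(1) by blast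
qed

lemma linked_class_no_crossing:
  "x \<in> linked C `` {r} \<Longrightarrow> y \<in> C - linked C `` {r} \<Longrightarrow> \<not> crosses x y"
  using linked_step[of r x C y] by blast

text \<open>A connected set of chords that crosses none of the other remaining chords is a full
  class, and the smallest endpoint selects which one. This identifies the first component after
  relabelling and after nesting.\<close>

lemma first_component_eqI:
  assumes "chord_set C" "X \<subseteq> C - {root_chord C}" "connected_diagram X"
    and "Min (\<Union>(C - {root_chord C})) \<in> \<Union>X"
    and "\<And>x y. x \<in> X \<Longrightarrow> y \<in> C - {root_chord C} - X \<Longrightarrow> \<not> crosses x y"
  shows "first_component C = X"
proof -
  have cs: "chord_set (C - {root_chord C})" by (rule chord_set_mono[OF assms(1)]) auto
  obtain c where c: "c \<in> X" "Min (\<Union>(C - {root_chord C})) \<in> c" using assms(4) by blast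
  then have "root_chord (C - {root_chord C}) = c"
    using assms(2) by (intro root_chord_eqI cs) auto
  then show ?thesis
    unfolding first_component_def using assms c by (intro linked_class_eqI) auto
qed

lemma
  assumes "chord_set C" "C - {root_chord C} \<noteq> {}"
  shows first_component_subset: "first_component C \<subseteq> C - {root_chord C}"
    and connected_first_component: "connected_diagram (first_component C)"
    and Min_in_first_component: "Min (\<Union>(C - {root_chord C})) \<in> \<Union>(first_component C)"
    and first_component_no_crossing:
      "\<And>x y. x \<in> first_component C \<Longrightarrow> y \<in> C - {root_chord C} - first_component C \<Longrightarrow> \<not> crosses x y"
proof -
  let ?C = "C - {root_chord C}"
  have cs: "chord_set ?C" by (rule chord_set_mono[OF assms(1)]) auto
  note r = root_chord_in[OF cs assms(2)]
  show "first_component C \<subseteq> ?C"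
    by (auto simp: first_component_def linked_def)
  show "connected_diagram (first_component C)"
    unfolding first_component_def by (rule connected_linked_class[OF r(1)])
  show "Min (\<Union>?C) \<in> \<Union>(first_component C)"
    unfolding first_component_def using r linked_refl[OF r(1)] by blast
  show "\<And>x y. x \<in> first_component C \<Longrightarrow> y \<in> ?C - first_component C \<Longrightarrow> \<not> crosses x y"
    unfolding first_component_def by (rule linked_class_no_crossing)
qed

lemma first_component_in_components:
  assumes "chord_set C" "C - {root_chord C} \<noteq> {}"
  shows "first_component C \<in> components_of (C - {root_chord C})"
proof -
  have cs: "chord_set (C - {root_chord C})" by (rule chord_set_mono[OF assms(1)]) auto
  show ?thesis
    unfolding first_component_def components_of_def
    by (rule quotientI[OF root_chord_in(1)[OF cs assms(2)]])
qed

text \<open>The first component attains the smallest endpoint of all remaining chords, so its sort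
  key is minimal; injectivity of the key on components makes it the head of the list.\<close>

lemma sorted_components_Cons:
  assumes "chord_set C" "C - {root_chord C} \<noteq> {}"
  obtains Ds where "sorted_components (C - {root_chord C}) = first_component C # Ds"
proof -
  let ?C = "C - {root_chord C}" and ?F = "first_component C"
  have cs: "chord_set ?C" by (rule chord_set_mono[OF assms(1)]) auto
  note F = first_component_in_components[OF assms]
  have finC: "finite (\<Union>?C)" by (rule chord_set_finite_Union[OF cs])
  have sub: "\<Union>X \<subseteq> \<Union>?C" if "X \<in> components_of ?C" for X
    using components_of_subset[OF that] by blast
  have ne: "\<Union>X \<noteq> {}" if "X \<in> components_of ?C" for X
    using chord_set_Min_in[OF chord_set_mono[OF cs components_of_subset[OF that]]
      components_of_nonempty[OF that]] by blast
  have MinF: "Min (\<Union>?F) = Min (\<Union>?C)"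
  proof (rule Min_eqI)
    show "finite (\<Union>?F)" using sub[OF F] finC by (rule finite_subset)
    show "Min (\<Union>?C) \<le> y" if "y \<in> \<Union>?F" for y
      using sub[OF F] that by (intro Min_le[OF finC]) blast
  qed (rule Min_in_first_component[OF assms])
  have le: "Min (\<Union>?F) \<le> Min (\<Union>X)" if "X \<in> components_of ?C" for X
    unfolding MinF by (rule Min_antimono[OF sub[OF that] ne[OF that] finC])
  obtain D Ds where eq: "sorted_components ?C = D # Ds"
    using F set_sorted_components[OF cs] by (cases "sorted_components ?C") auto
  have D: "D \<in> components_of ?C" using set_sorted_components[OF cs] eq by auto
  have "Min (\<Union>D) \<le> Min (\<Union>?F)"
    using sorted_sorted_components[OF cs] set_sorted_components[OF cs] F eq by auto
  with le[OF D] have "Min (\<Union>D) = Min (\<Union>?F)" by simp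
  then have "D = ?F" using inj_on_Min_components[OF cs] D F by (auto dest: inj_onD)
  then show ?thesis using that eq by blast
qed

lemma intersection_order_root:
  "chord_set C \<Longrightarrow> C \<noteq> {} \<Longrightarrow> intersection_order C =
    root_chord C # concat (map intersection_order (sorted_components (C - {root_chord C})))"
  by (subst intersection_order.simps) simp

lemma intersection_order_first_component:
  assumes "chord_set C" "C - {root_chord C} \<noteq> {}"
  obtains cs where "intersection_order C = root_chord C # intersection_order (first_component C) @ cs"
proof -
  obtain Ds where "sorted_components (C - {root_chord C}) = first_component C # Ds"
    by (rule sorted_components_Cons[OF assms])
  moreover have "C \<noteq> {}" using assms(2) by blast
  ultimately show ?thesis using that intersection_order_root[OF assms(1)] by simp
qed

section \<open>Terminal chords and the index of the first one\<close>

lemma terminal_chord_iff: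
  "terminal_chord C c \<longleftrightarrow> c \<in> C \<and> (\<forall>d\<in>C. crosses c d \<longrightarrow> Min d < Min c)"
  by (auto simp: terminal_chord_def intersection_edges_def crosses_def)

text \<open>A chord with the largest right endpoint has no outgoing edge. Hence the
  \<open>LEAST\<close> in \<open>first_terminal_index\<close> is attained.\<close>

lemma ex_terminal_chord:
  assumes "chord_set C" "C \<noteq> {}"
  shows "\<exists>c. terminal_chord C c"
proof -
  have fin: "finite C" using assms by (simp add: chord_set_def)
  have "Max (Max ` C) \<in> Max ` C" using fin assms(2) by (intro Max_in) auto
  then obtain c where c: "c \<in> C" "Max c = Max (Max ` C)" by (metis imageE)
  then have "Max d \<le> Max c" if "d \<in> C" for d using fin that by simp
  then show ?thesis using c(1) unfolding terminal_chord_iff crosses_def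
    by (meson leD)
qed

lemma first_terminal_index_props:
  assumes "chord_set C" "C \<noteq> {}"
  shows "1 \<le> first_terminal_index C"
    and "first_terminal_index C \<le> length (intersection_order C)"
    and "terminal_chord C (intersection_order C ! (first_terminal_index C - 1))"
proof -
  obtain c where c: "terminal_chord C c" using ex_terminal_chord[OF assms] ..
  then have "c \<in> set (intersection_order C)"
    using set_intersection_order[OF assms(1)] by (simp add: terminal_chord_iff)
  then obtain i where i: "i < length (intersection_order C)" "intersection_order C ! i = c"
    by (auto simp: in_set_conv_nth)
  have "1 \<le> Suc i \<and> Suc i \<le> length (intersection_order C) \<and>
      terminal_chord C (intersection_order C ! (Suc i - 1))"
    using i c by simp
  from LeastI[of "\<lambda>i. 1 \<le> i \<and> i \<le> length (intersection_order C) \<and>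
        terminal_chord C (intersection_order C ! (i - 1))", OF this]
  show "1 \<le> first_terminal_index C"
    and "first_terminal_index C \<le> length (intersection_order C)"
    and "terminal_chord C (intersection_order C ! (first_terminal_index C - 1))"
    by (simp_all add: first_terminal_index_def)
qed

lemma first_terminal_index_le:
  "1 \<le> i \<Longrightarrow> i \<le> length (intersection_order C) \<Longrightarrow>
    terminal_chord C (intersection_order C ! (i - 1)) \<Longrightarrow> first_terminal_index C \<le> i"
  unfolding first_terminal_index_def by (rule Least_le) simp

lemma first_terminal_index_singleton:
  assumes "chord_set C" "C = {c}"
  shows "first_terminal_index C = 1"
proof -
  have "root_chord C = c" using root_chord_in[OF assms(1)] assms(2) by auto
  then have "intersection_order C ! (1 - 1) = c" "length (intersection_order C) \<ge> 1"
    using intersection_order_root[OF assms(1)] assms(2) by auto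
  moreover have "terminal_chord C c"
    using assms(2) by (auto simp: terminal_chord_iff crosses_def)
  ultimately have "first_terminal_index C \<le> 1"
    by (intro first_terminal_index_le) auto
  then show ?thesis using first_terminal_index_props(1)[OF assms(1)] assms(2) by auto
qed

lemma Min_root_chord_less:
  assumes "chord_set C" "d \<in> C" "d \<noteq> root_chord C"
  shows "Min (root_chord C) < Min d"
proof -
  have ne: "C \<noteq> {}" using assms by auto
  have "Min d \<in> d" using chord_Min_Max(1)[OF assms(1,2)] by blast
  then have "Min (\<Union>C) \<le> Min d"
    using assms chord_set_finite_Union[OF assms(1)] by (auto intro: Min_le)
  moreover have "Min (\<Union>C) \<noteq> Min d"
    using \<open>Min d \<in> d\<close> assms root_chord_eqI by metis
  ultimately show ?thesis using Min_root_chord[OF assms(1) ne] by simp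
qed

text \<open>The intersection order lists the first component directly after the root, so it suffices
  that the root is not terminal and that terminality of the chords of this component is not affected
  by the rest of \<open>C\<close>.\<close>

lemma first_terminal_index_rec:
  assumes C: "chord_set C" "connected_diagram C" "C - {root_chord C} \<noteq> {}"
  shows "first_terminal_index C = Suc (first_terminal_index (first_component C))"
proof -
  let ?r = "root_chord C" and ?F = "first_component C"
  have ne: "C \<noteq> {}" using C(3) by auto
  note r = root_chord_in[OF C(1) ne]
  note sub = first_component_subset[OF C(1,3)]
  have csF: "chord_set ?F" using sub by (intro chord_set_mono[OF C(1)]) auto
  have neF: "?F \<noteq> {}" using connected_first_component[OF C(1,3)] by (simp add: connected_diagram_def)
  obtain cs where io: "intersection_order C = ?r # intersection_order ?F @ cs"
    by (rule intersection_order_first_component[OF C(1,3)])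
  have term_iff: "terminal_chord C c \<longleftrightarrow> terminal_chord ?F c" if "c \<in> ?F" for c
  proof -
    \<comment> \<open>Outside \<open>?F\<close> only the root can cross \<open>c\<close>, and it
      starts before \<open>c\<close>, so it is not the target of an edge from
      \<open>c\<close>.\<close>
    have "Min d < Min c" if "d \<in> C - ?F" "crosses c d" for d
      using first_component_no_crossing[OF C(1,3) \<open>c \<in> ?F\<close>, of d] that sub \<open>c \<in> ?F\<close>
        Min_root_chord_less[OF C(1), of c] by blast
    then show ?thesis using that sub unfolding terminal_chord_iff by blast
  qed
  have nterm: "\<not> terminal_chord C ?r"
  proof
    assume t: "terminal_chord C ?r"
    \<comment> \<open>The root starts first, so every crossing with it is an outgoing edge; a
      terminal root would be a component of its own.\<close>
    have "{?r} = C"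
    proof (rule connected_diagramD[OF C(2)])
      fix x y assume "x \<in> {?r}" "y \<in> C - {?r}"
      then show "\<not> crosses x y"
        using t Min_root_chord_less[OF C(1), of y] by (auto simp: terminal_chord_iff)
    qed (use r in auto)
    then show False using C(3) by blast
  qed
  have inF: "intersection_order ?F ! i \<in> ?F" if "i < length (intersection_order ?F)" for i
    using that set_intersection_order[OF csF] nth_mem by blast
  note F = first_terminal_index_props[OF csF neF]
  note P = first_terminal_index_props[OF C(1) ne]
  show ?thesis
  proof (rule antisym)
    show "first_terminal_index C \<le> Suc (first_terminal_index ?F)"
      using F inF[of "first_terminal_index ?F - 1"]
      by (intro first_terminal_index_le) (auto simp: io nth_Cons' nth_append term_iff)
    show "Suc (first_terminal_index ?F) \<le> first_terminal_index C"
    proof (rule ccontr)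
      assume less: "\<not> ?thesis"
      let ?i = "first_terminal_index C"
      have "?i \<noteq> 1" using P(3) nterm by (auto simp: io)
      then have i: "?i \<ge> 2" using P(1) by simp
      \<comment> \<open>One subtraction passes from positions counted from 1 to list positions, the
        other skips the root.\<close>
      then have nth: "intersection_order C ! (?i - 1) = intersection_order ?F ! (?i - 1 - 1)"
        using less F(2) by (auto simp: io nth_Cons' nth_append)
      have lt: "?i - 1 - 1 < length (intersection_order ?F)" using less F(2) i by auto
      have "terminal_chord ?F (intersection_order ?F ! (?i - 1 - 1))"
        using P(3) inF[OF lt] unfolding nth by (simp add: term_iff)
      then have "first_terminal_index ?F \<le> ?i - 1"
        using i lt by (intro first_terminal_index_le) auto
      then show False using less i by simp
    qed
  qed
qed

text \<open>Passing to the first component lowers the index by exactly one and the number of chords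
  by at least one.\<close>

lemma first_terminal_index_le_card:
  assumes "chord_set C" "connected_diagram C"
  shows "first_terminal_index C \<le> card C"
  using assms
proof (induction "card C" arbitrary: C rule: less_induct)
  case less
  have ne: "C \<noteq> {}" using less.prems by (simp add: connected_diagram_def)
  have fin: "finite C" using less.prems by (simp add: chord_set_def)
  note r = root_chord_in(1)[OF less.prems(1) ne]
  show ?case
  proof (cases "C - {root_chord C} = {}")
    case True
    then have "C = {root_chord C}" using r by blast
    then show ?thesis
      using first_terminal_index_singleton[OF less.prems(1)] by (metis card_1_singleton_iff One_nat_def order_refl)
  next
    case False
    note sub = first_component_subset[OF less.prems(1) False]
    have "card (first_component C) \<le> card (C - {root_chord C})"
      using fin sub by (intro card_mono) auto
    also have "\<dots> < card C" using fin r by (intro psubset_card_mono) auto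
    finally have lt: "card (first_component C) < card C" .
    then have "first_terminal_index (first_component C) \<le> card (first_component C)"
      using less.hyps chord_set_mono[OF less.prems(1)] sub
        connected_first_component[OF less.prems(1) False] by blast
    then show ?thesis
      using first_terminal_index_rec[OF less.prems False] lt by simp
  qed
qed

section \<open>Relabelling\<close>

definition relabel :: "(nat \<Rightarrow> nat) \<Rightarrow> nat set set \<Rightarrow> nat set set" where
  "relabel f C = image f ` C"

lemma Union_relabel: "\<Union>(relabel f C) = f ` \<Union>C"
  by (auto simp: relabel_def)

lemma relabel_empty_iff [simp]: "relabel f C = {} \<longleftrightarrow> C = {}"
  by (simp add: relabel_def)

lemma strict_mono_inj: "strict_mono (f :: nat \<Rightarrow> nat) \<Longrightarrow> inj f"
  by (rule strict_mono_imp_inj_on)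

lemma inj_image_strict_mono: "strict_mono f \<Longrightarrow> inj (image (f :: nat \<Rightarrow> nat))"
  by (auto simp: inj_on_def inj_image_eq_iff[OF strict_mono_inj])

lemma inj_relabel: "strict_mono f \<Longrightarrow> inj (relabel f)"
  by (auto simp: inj_on_def relabel_def inj_image_eq_iff[OF inj_image_strict_mono])

lemma chord_set_relabel_iff:
  assumes f: "strict_mono f"
  shows "chord_set (relabel f C) \<longleftrightarrow> chord_set C"
proof -
  note inj = strict_mono_inj[OF f]
  have "finite (relabel f C) \<longleftrightarrow> finite C"
    unfolding relabel_def by (rule finite_image_iff[OF inj_on_subset[OF inj_image_strict_mono[OF f]]]) simp
  moreover have "disjoint (relabel f C) \<longleftrightarrow> disjoint C"
    using inj unfolding relabel_def disjoint_def
    by (simp add: inj_image_eq_iff flip: image_Int)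
  moreover have "card (f ` c) = card c" for c
    by (rule card_image[OF inj_on_subset[OF inj]]) simp
  ultimately show ?thesis by (simp add: chord_set_def relabel_def)
qed

lemma Min_image_chord:
  assumes "chord_set C" "c \<in> C" "strict_mono f"
  shows "Min (f ` c) = f (Min c)" "Max (f ` c) = f (Max c)"
proof -
  have "finite c" "c \<noteq> {}" using assms by (auto simp: chord_set_def intro: card_ge_0_finite)
  then show "Min (f ` c) = f (Min c)" "Max (f ` c) = f (Max c)"
    using mono_Min_commute mono_Max_commute strict_mono_mono[OF assms(3)] by metis+
qed

lemma crosses_image_iff:
  assumes "chord_set C" "c \<in> C" "d \<in> C" "strict_mono f"
  shows "crosses (f ` c) (f ` d) \<longleftrightarrow> crosses c d"
  using assms by (simp add: crosses_def Min_image_chord[where C = C] strict_mono_less)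

text \<open>Cuts are transported along the injection on chords. Both directions are needed for the
  bijection in \<open>card_connected_on_image\<close>.\<close>

lemma connected_relabel_iff:
  assumes C: "chord_set C" and f: "strict_mono f"
  shows "connected_diagram (relabel f C) \<longleftrightarrow> connected_diagram C"
proof
  have inj: "inj (image f)" by (rule inj_image_strict_mono[OF f])
  {
    assume con: "connected_diagram (relabel f C)"
    then obtain r where "r \<in> C" by (auto simp: connected_diagram_def)
    then show "connected_diagram C"
    proof (rule connected_diagramI)
      fix X assume X: "X \<subseteq> C" "r \<in> X" "\<And>x y. x \<in> X \<Longrightarrow> y \<in> C - X \<Longrightarrow> \<not> crosses x y"
      have "relabel f X = relabel f C"
      proof (rule connected_diagramD[OF con])
        fix x y assume "x \<in> relabel f X" "y \<in> relabel f C - relabel f X"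
        then obtain x' y' where "x' \<in> X" "y' \<in> C - X" "x = f ` x'" "y = f ` y'"
          by (auto simp: relabel_def)
        then show "\<not> crosses x y" using X crosses_image_iff[OF C _ _ f, of x' y'] by auto
      qed (use X in \<open>auto simp: relabel_def\<close>)
      then show "X = C" using inj_relabel[OF f] by (simp add: inj_eq)
    qed
  next
    assume con: "connected_diagram C"
    then obtain r where "r \<in> C" by (auto simp: connected_diagram_def)
    then have "f ` r \<in> relabel f C" by (simp add: relabel_def)
    then show "connected_diagram (relabel f C)"
    proof (rule connected_diagramI)
      fix Y assume Y: "Y \<subseteq> relabel f C" "f ` r \<in> Y"
        "\<And>x y. x \<in> Y \<Longrightarrow> y \<in> relabel f C - Y \<Longrightarrow> \<not> crosses x y"
      define X where "X = {c \<in> C. f ` c \<in> Y}"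
      have "X = C"
      proof (rule connected_diagramD[OF con])
        fix x y assume "x \<in> X" "y \<in> C - X"
        then show "\<not> crosses x y"
          using Y(3)[of "f ` x" "f ` y"] crosses_image_iff[OF C _ _ f, of x y]
          by (auto simp: X_def relabel_def)
      qed (use Y(2) \<open>r \<in> C\<close> in \<open>auto simp: X_def\<close>)
      then show "Y = relabel f C" using Y(1) by (auto simp: X_def relabel_def)
    qed
  }
qed

lemma Min_Union_relabel:
  assumes "chord_set C" "C \<noteq> {}" "strict_mono f"
  shows "Min (\<Union>(relabel f C)) = f (Min (\<Union>C))"
proof -
  have "\<Union>C \<noteq> {}" using chord_set_Min_in[OF assms(1,2)] by blast
  then show ?thesis
    using mono_Min_commute[OF strict_mono_mono[OF assms(3)] chord_set_finite_Union[OF assms(1)]]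
    by (simp add: Union_relabel)
qed

lemma root_chord_relabel:
  assumes "chord_set C" "C \<noteq> {}" "strict_mono f"
  shows "root_chord (relabel f C) = f ` root_chord C"
  using root_chord_in[OF assms(1,2)] assms
  by (intro root_chord_eqI)
     (auto simp: chord_set_relabel_iff Min_Union_relabel, auto simp: relabel_def)

lemma relabel_Diff: "strict_mono f \<Longrightarrow> relabel f (C - X) = relabel f C - relabel f X"
  unfolding relabel_def by (rule image_set_diff[OF inj_image_strict_mono])

lemma relabel_singleton: "relabel f {c} = {f ` c}"
  by (simp add: relabel_def)

lemma first_component_relabel:
  assumes C: "chord_set C" "C - {root_chord C} \<noteq> {}" and f: "strict_mono f"
  shows "first_component (relabel f C) = relabel f (first_component C)"
proof -
  have ne: "C \<noteq> {}" using C(2) by blast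
  have sub: "first_component C \<subseteq> C - {root_chord C}" by (rule first_component_subset[OF C])
  have cs: "chord_set (C - {root_chord C})" by (rule chord_set_mono[OF C(1)]) blast
  have csF: "chord_set (first_component C)" by (rule chord_set_mono[OF cs sub])
  have D: "relabel f C - {root_chord (relabel f C)} = relabel f (C - {root_chord C})"
    by (simp add: root_chord_relabel[OF C(1) ne f] relabel_Diff[OF f] relabel_singleton)
  show ?thesis
  proof (rule first_component_eqI, unfold D)
    show "chord_set (relabel f C)" using C f by (simp add: chord_set_relabel_iff)
    show "relabel f (first_component C) \<subseteq> relabel f (C - {root_chord C})"
      using sub by (auto simp: relabel_def)
    show "connected_diagram (relabel f (first_component C))"
      using connected_first_component[OF C] by (simp add: connected_relabel_iff[OF csF f])
    show "Min (\<Union>(relabel f (C - {root_chord C}))) \<in> \<Union>(relabel f (first_component C))"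
      unfolding Min_Union_relabel[OF cs C(2) f] unfolding Union_relabel
      by (rule imageI[OF Min_in_first_component[OF C]])
    fix x y assume "x \<in> relabel f (first_component C)"
      "y \<in> relabel f (C - {root_chord C}) - relabel f (first_component C)"
    then obtain x' y' where "x' \<in> first_component C" "y' \<in> C - {root_chord C} - first_component C"
      "x = f ` x'" "y = f ` y'"
      by (auto simp: relabel_def)
    then show "\<not> crosses x y"
      using first_component_no_crossing[OF C, of x' y'] crosses_image_iff[OF cs _ _ f, of x' y'] sub
      by blast
  qed
qed

text \<open>Induction along first components by \<open>first_terminal_index_rec\<close>, which
  avoids transporting the whole intersection order and its sorted lists of components.\<close>

lemma first_terminal_index_relabel:
  assumes "chord_set C" "connected_diagram C" and f: "strict_mono f"
  shows "first_terminal_index (relabel f C) = first_terminal_index C"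
  using assms(1,2)
proof (induction "card C" arbitrary: C rule: less_induct)
  case less
  have ne: "C \<noteq> {}" using less.prems by (simp add: connected_diagram_def)
  have fin: "finite C" using less.prems by (simp add: chord_set_def)
  note r = root_chord_in(1)[OF less.prems(1) ne]
  have cs: "chord_set (relabel f C)" using less.prems f by (simp add: chord_set_relabel_iff)
  show ?case
  proof (cases "C - {root_chord C} = {}")
    case True
    then have C: "C = {root_chord C}" using r by blast
    then have "relabel f C = {f ` root_chord C}" by (metis relabel_singleton)
    then show ?thesis
      using first_terminal_index_singleton[OF less.prems(1) C] first_terminal_index_singleton[OF cs]
      by simp
  next
    case False
    note sub = first_component_subset[OF less.prems(1) False]
    have "card (first_component C) \<le> card (C - {root_chord C})"
      using fin sub by (intro card_mono) auto
    also have "\<dots> < card C" using fin r by (intro psubset_card_mono) auto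
    finally have IH: "first_terminal_index (relabel f (first_component C)) =
        first_terminal_index (first_component C)"
      using less.hyps chord_set_mono[OF less.prems(1)] sub
        connected_first_component[OF less.prems(1) False] by blast
    have "relabel f C - {root_chord (relabel f C)} = relabel f (C - {root_chord C})"
      by (simp add: root_chord_relabel[OF less.prems(1) ne f] relabel_Diff[OF f] relabel_singleton)
    then have "relabel f C - {root_chord (relabel f C)} \<noteq> {}" using False by simp
    then have "first_terminal_index (relabel f C) = Suc (first_terminal_index (first_component (relabel f C)))"
      using less.prems cs f by (intro first_terminal_index_rec) (auto simp: connected_relabel_iff)
    then show ?thesis
      using first_terminal_index_rec[OF less.prems False] IH
        first_component_relabel[OF less.prems(1) False f] by simp
  qed
qed

text \<open>The endpoint set is arbitrary so that the two pieces of a diagram can be counted in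
  place before relabelling. The threshold is an integer because \<open>n - k\<close> may be
  negative; \<open>t = 0\<close> imposes no condition.\<close>

definition connected_on :: "nat set \<Rightarrow> int \<Rightarrow> nat set set set" where
  "connected_on S t = {C. chord_set C \<and> \<Union>C = S \<and> connected_diagram C \<and> t \<le> int (first_terminal_index C)}"

lemma finite_connected_on: "finite S \<Longrightarrow> finite (connected_on S t)"
  by (rule finite_subset[of _ "Pow (Pow S)"]) (auto simp: connected_on_def)

lemma num_diagrams_eq: "num_diagrams n k = card (connected_on {1..2 * n} (int n - int k))"
  by (simp add: num_diagrams_def connected_on_def chord_diagram_iff conj_assoc)

lemma card_connected_on_image:
  assumes f: "strict_mono f"
  shows "card (connected_on (f ` S) t) = card (connected_on S t)"
proof -
  have "connected_on (f ` S) t = relabel f ` connected_on S t"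
  proof (intro equalityI subsetI)
    fix D assume D: "D \<in> connected_on (f ` S) t"
    \<comment> \<open>\<open>inv f\<close> need not be monotone off the range of \<open>f\<close>.
      It only supplies a preimage, whose properties follow from those of \<open>D\<close> by the
      equivalences for relabelling with \<open>f\<close>.\<close>
    define C where "C = relabel (inv f) D"
    have img: "f ` inv f ` c = c" if "c \<in> D" for c
    proof -
      have "c \<subseteq> range f" using D that by (auto simp: connected_on_def)
      then show ?thesis by (auto simp: image_image f_inv_into_f subset_iff)
    qed
    have DC: "D = relabel f C"
      using img by (force simp: C_def relabel_def image_image)
    then have "f ` \<Union>C = f ` S" using D by (simp add: connected_on_def Union_relabel)
    then have "\<Union>C = S" by (simp add: inj_image_eq_iff[OF strict_mono_inj[OF f]])
    moreover have cs: "chord_set C" using D f DC by (simp add: connected_on_def chord_set_relabel_iff)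
    moreover have con: "connected_diagram C"
      using D f DC cs by (simp add: connected_on_def connected_relabel_iff)
    ultimately have "C \<in> connected_on S t"
      using D f first_terminal_index_relabel[OF cs con f] unfolding DC by (simp add: connected_on_def)
    then show "D \<in> relabel f ` connected_on S t" using DC by blast
  next
    fix D assume "D \<in> relabel f ` connected_on S t"
    then obtain C where "C \<in> connected_on S t" "D = relabel f C" by blast
    then show "D \<in> connected_on (f ` S) t"
      using f by (auto simp: connected_on_def chord_set_relabel_iff connected_relabel_iff
        first_terminal_index_relabel Union_relabel)
  qed
  then show ?thesis
    using inj_relabel[OF f] by (simp add: card_image inj_on_subset)
qed

lemma card_connected_on_gap:
  assumes "3 \<le> a" "a + 2 * j < 2 * n"
  shows "card (connected_on ({2..2 * n} - {a..a + 2 * j}) t) = card (connected_on {1..2 * (n - 1 - j)} t)"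
proof -
  \<comment> \<open>On positive arguments the values skip 1, which belongs to the root, and the
    \<open>2 * j + 1\<close> points of the removed interval.\<close>
  define f where "f i = (if i < a - 1 then i + 1 else i + 2 * j + 2)" for i
  have f: "strict_mono f" by (auto simp: strict_mono_def f_def)
  have "f ` {1..2 * (n - 1 - j)} = {2..2 * n} - {a..a + 2 * j}"
  proof (intro equalityI subsetI)
    fix x assume "x \<in> f ` {1..2 * (n - 1 - j)}"
    then show "x \<in> {2..2 * n} - {a..a + 2 * j}" using assms by (auto simp: f_def)
  next
    fix x assume x: "x \<in> {2..2 * n} - {a..a + 2 * j}"
    show "x \<in> f ` {1..2 * (n - 1 - j)}"
    proof (cases "x < a")
      case True
      then show ?thesis using x assms by (intro image_eqI[of _ _ "x - 1"]) (auto simp: f_def)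
    next
      case False
      then show ?thesis using x assms
        by (intro image_eqI[of _ _ "x - 2 * j - 2"]) (auto simp: f_def)
    qed
  qed
  then show ?thesis using card_connected_on_image[OF f] by metis
qed

lemma card_connected_on_insert:
  assumes "3 \<le> a"
  shows "card (connected_on (insert 1 {a..a + 2 * j}) t) = card (connected_on {1..2 * (j + 1)} t)"
proof -
  \<comment> \<open>Fixes 0 and 1 and moves 2 to \<open>a\<close>, so that the points after 1 become
    the interval starting at \<open>a\<close>.\<close>
  define f where "f i = (if i < 2 then i else i + a - 2)" for i
  have f: "strict_mono f" using assms by (auto simp: strict_mono_def f_def)
  have "f ` {1..2 * (j + 1)} = insert 1 {a..a + 2 * j}"
  proof (intro equalityI subsetI)
    fix x assume "x \<in> f ` {1..2 * (j + 1)}"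
    then show "x \<in> insert 1 {a..a + 2 * j}" using assms by (auto simp: f_def)
  next
    fix x assume x: "x \<in> insert 1 {a..a + 2 * j}"
    show "x \<in> f ` {1..2 * (j + 1)}"
    proof (cases "x = 1")
      case True
      then show ?thesis by (intro image_eqI[of _ _ 1]) (auto simp: f_def)
    next
      case False
      then show ?thesis using x assms
        by (intro image_eqI[of _ _ "x + 2 - a"]) (auto simp: f_def)
    qed
  qed
  then show ?thesis using card_connected_on_image[OF f] by metis
qed

section \<open>Decomposition at the first component\<close>

lemma chord_endpoint:
  assumes "chord_set C" "c \<in> C" "x \<in> c"
  shows "x = Min c \<or> x = Max c"
  using chord_obtain[OF assms(1,2)] assms(3) by (metis insertE singletonD)

lemma Min_Max_in_chord:
  assumes "chord_set C" "c \<in> C"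
  shows "Min c \<in> c" "Max c \<in> c"
  using chord_Min_Max(1)[OF assms] by blast+

lemma Min_Max_in_Union:
  assumes "chord_set C" "c \<in> C"
  shows "Min c \<in> \<Union>C" "Max c \<in> \<Union>C"
  using chord_Min_Max(1)[OF assms] assms(2) by blast+

lemma chord_set_Un:
  assumes "chord_set F" "chord_set D" "\<Union>F \<inter> \<Union>D = {}"
  shows "chord_set (F \<union> D)"
proof -
  have "disjoint (F \<union> D)"
    using assms by (intro disjoint_union) (simp_all add: chord_set_def)
  then show ?thesis using assms by (auto simp: chord_set_def)
qed

text \<open>The chord diagram \<open>F\<close> is nested around the interval \<open>T\<close> that contains all endpoints of \<open>D\<close>
  except that of its root; connectedness of \<open>F\<close> yields a chord over \<open>T\<close>, and this chord crosses the
  root.\<close>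

lemma nested_union:
  fixes a j n :: nat
  defines "T \<equiv> {a..a + 2 * j}"
  assumes a: "3 \<le> a" "a + 2 * j < 2 * n"
    and F: "chord_set F" "\<Union>F = {2..2 * n} - T" "connected_diagram F"
    and D: "chord_set D" "\<Union>D = insert 1 T" "connected_diagram D"
  shows "chord_set (F \<union> D)" "\<Union>(F \<union> D) = {1..2 * n}" "connected_diagram (F \<union> D)"
    and "F \<inter> D = {}" "first_component (F \<union> D) = F"
    and "first_terminal_index (F \<union> D) = Suc (first_terminal_index F)"
proof -
  have dj: "\<Union>F \<inter> \<Union>D = {}" using a F(2) D(2) by (auto simp: T_def)
  show cs: "chord_set (F \<union> D)" by (rule chord_set_Un[OF F(1) D(1) dj])
  show U: "\<Union>(F \<union> D) = {1..2 * n}"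
    using a F(2) D(2) by (auto simp: T_def)
  have neF: "F \<noteq> {}" and neD: "D \<noteq> {}" using F(3) D(3) by (auto simp: connected_diagram_def)
  show FD: "F \<inter> D = {}"
  proof (rule ccontr)
    assume "F \<inter> D \<noteq> {}"
    then obtain c where "c \<in> F" "c \<in> D" by blast
    then show False using dj Min_Max_in_Union(1)[OF F(1), of c] Min_Max_in_Union(1)[OF D(1), of c] by blast
  qed
  have MinD: "Min (\<Union>D) = 1" unfolding D(2) using a by (intro Min_eqI) (auto simp: T_def)
  have MinU: "Min (\<Union>(F \<union> D)) = 1" unfolding U using a by (intro Min_eqI) auto
  define r where "r = root_chord D"
  have r: "r \<in> D" "1 \<in> r" using root_chord_in[OF D(1) neD] MinD by (auto simp: r_def)
  have rC: "root_chord (F \<union> D) = r"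
    using r MinU by (intro root_chord_eqI[OF cs]) (simp_all del: Union_Un_distrib)
  have Minr: "Min r = 1" using Min_root_chord[OF D(1) neD] MinD by (simp add: r_def)
  have Maxr: "Max r \<in> T"
    using Min_Max_in_Union(2)[OF D(1) r(1)] chord_Min_Max(2)[OF D(1) r(1)] Minr D(2) by auto
  have F_end: "Min f \<ge> 2" "Min f < a \<or> Min f > a + 2 * j" "Max f < a \<or> Max f > a + 2 * j" "Min f < Max f"
    if "f \<in> F" for f
    using Min_Max_in_Union[OF F(1) that] chord_Min_Max(2)[OF F(1) that] F(2) by (auto simp: T_def)
  have D_end: "Min d \<in> T" "Max d \<in> T" if d: "d \<in> D" "d \<noteq> r" for d
  proof -
    have "1 \<notin> d" using chord_set_eq[OF D(1) d(1) r(1) _ r(2)] d(2) by blast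
    then have "Min d \<noteq> 1" "Max d \<noteq> 1" using Min_Max_in_chord[OF D(1) d(1)] by metis+
    then show "Min d \<in> T" "Max d \<in> T" using Min_Max_in_Union[OF D(1) d(1)] D(2) by auto
  qed
  have nc: "\<not> crosses f d" if "f \<in> F" "d \<in> D" "d \<noteq> r" for f d
    using F_end[OF that(1)] D_end[OF that(2,3)] by (auto simp: crosses_def T_def)
  have "\<exists>f\<in>F. Min f < a \<and> Max f > a + 2 * j"
  proof (rule ccontr)
    assume "\<not> ?thesis"
    then have split: "Max f < a \<or> Min f > a + 2 * j" if "f \<in> F" for f
      using F_end[OF that] that by force
    have "2 \<in> \<Union>F" "2 * n \<in> \<Union>F" using a F(2) by (auto simp: T_def)
    then obtain f g where f: "f \<in> F" "2 \<in> f" and g: "g \<in> F" "2 * n \<in> g" by blast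
    have "2 = Min f \<or> 2 = Max f" "2 * n = Min g \<or> 2 * n = Max g"
      using f g chord_endpoint[OF F(1)] by blast+
    then have fg: "Max f < a" "\<not> Max g < a"
      using split[OF f(1)] split[OF g(1)] F_end[OF f(1)] F_end[OF g(1)] a by auto
    \<comment> \<open>If no chord of \<open>F\<close> passes over \<open>T\<close>, those to its
      left form a cut; it contains the chord at 2 but not the one at \<open>2 * n\<close>.\<close>
    have "{c \<in> F. Max c < a} = F"
    proof (rule connected_diagramD[OF F(3)])
      fix x y assume "x \<in> {c \<in> F. Max c < a}" "y \<in> F - {c \<in> F. Max c < a}"
      then show "\<not> crosses x y" using split[of x] split[of y] by (auto simp: crosses_def)
    qed (use f fg in auto)
    then show False using g fg by blast
  qed
  then obtain f where f: "f \<in> F" "Min f < a" "Max f > a + 2 * j" by blast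
  have fr: "crosses f r" using f F_end[OF f(1)] Minr Maxr by (auto simp: crosses_def T_def)
  show con: "connected_diagram (F \<union> D)"
  proof (rule connected_diagramI)
    show "r \<in> F \<union> D" using r by simp
    fix X assume X: "X \<subseteq> F \<union> D" "r \<in> X" "\<And>x y. x \<in> X \<Longrightarrow> y \<in> F \<union> D - X \<Longrightarrow> \<not> crosses x y"
    have "X \<inter> D = D"
      using X r by (intro connected_diagramD[OF D(3)]) auto
    moreover have "f \<in> X" using X(3)[OF X(2), of f] f(1) crosses_sym[OF fr] by blast
    then have "X \<inter> F = F"
      using X f(1) by (intro connected_diagramD[OF F(3)]) auto
    ultimately show "X = F \<union> D" using X(1) by blast
  qed
  have rF: "r \<notin> F" using FD r by blast
  show fc: "first_component (F \<union> D) = F"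
  proof (rule first_component_eqI[OF cs], unfold rC)
    show "F \<subseteq> F \<union> D - {r}" using rF by blast
    show "connected_diagram F" by (rule F(3))
    \<comment> \<open>With the root gone the smallest endpoint is 2, which lies outside
      \<open>T\<close> because \<open>3 \<le> a\<close> and so belongs to \<open>F\<close>.\<close>
    have "Min (\<Union>(F \<union> D - {r})) = 2"
    proof (rule Min_eqI)
      show "finite (\<Union>(F \<union> D - {r}))"
        by (rule chord_set_finite_Union[OF chord_set_mono[OF cs]]) blast
      have "2 \<in> \<Union>F" using a F(2) by (auto simp: T_def)
      then show "2 \<in> \<Union>(F \<union> D - {r})" using rF by blast
      fix y assume "y \<in> \<Union>(F \<union> D - {r})"
      then obtain d where d: "d \<in> F \<union> D" "d \<noteq> r" "y \<in> d" by blast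
      then have "y \<noteq> 1" using chord_set_eq[OF cs d(1) _ _ r(2)] r(1) by blast
      moreover have "y \<in> {1..2 * n}" using d U by blast
      ultimately show "2 \<le> y" by auto
    qed
    then show "Min (\<Union>(F \<union> D - {r})) \<in> \<Union>F" using a F(2) by (auto simp: T_def)
    fix x y assume "x \<in> F" "y \<in> F \<union> D - {r} - F"
    then show "\<not> crosses x y" using nc by blast
  qed
  show "first_terminal_index (F \<union> D) = Suc (first_terminal_index F)"
    using first_terminal_index_rec[OF cs con] neF rF unfolding rC fc by blast
qed

lemma interval_eqI:
  fixes T :: "nat set"
  assumes "finite T" "T \<noteq> {}" "\<And>x y z. x \<in> T \<Longrightarrow> z \<in> T \<Longrightarrow> x \<le> y \<Longrightarrow> y \<le> z \<Longrightarrow> y \<in> T"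
  shows "T = {Min T..Max T}"
proof
  show "T \<subseteq> {Min T..Max T}" using assms(1) by auto
  show "{Min T..Max T} \<subseteq> T"
    using assms(3)[OF Min_in[OF assms(1,2)] Max_in[OF assms(1,2)]] by auto
qed

text \<open>The induction step for spreading along crossing chords: if the hull of \<open>e\<close>
  with one chord and the span of an overlapping chord both avoid a set, so does the hull of
  \<open>e\<close> with the second chord.\<close>

lemma interval_hull_overlap:
  fixes e p q p' q' :: nat
  assumes "p \<le> q'" "p' \<le> q"
  shows "{min e p..max e q} \<subseteq> {min e p'..max e q'} \<union> {p..q}"
proof
  fix x assume "x \<in> {min e p..max e q}"
  then have "(e \<le> x \<or> p \<le> x) \<and> (x \<le> e \<or> x \<le> q)" by (simp add: min_le_iff_disj le_max_iff_disj)
  then have "(e \<le> x \<or> p' \<le> x) \<and> (x \<le> e \<or> x \<le> q') \<or> p \<le> x \<and> x \<le> q"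
    using assms by linarith
  then show "x \<in> {min e p'..max e q'} \<union> {p..q}"
    by (simp add: min_le_iff_disj le_max_iff_disj)
qed

text \<open>The converse of \<open>nested_union\<close>. With \<open>S\<close> the endpoints of the
  first component and \<open>e\<close> the right end of the root, no point of \<open>S\<close> lies
  between \<open>e\<close> and a point of \<open>{2..2 * n} - S\<close>; hence the latter set is an
  interval.\<close>

lemma gap_of_first_component:
  assumes C: "chord_set C" "\<Union>C = {1..2 * n}" "connected_diagram C" and n: "2 \<le> n"
  defines "F \<equiv> first_component C"
  obtains a j where "3 \<le> a" "a + 2 * j < 2 * n" "\<Union>F = {2..2 * n} - {a..a + 2 * j}"
    "\<Union>(C - F) = insert 1 {a..a + 2 * j}" "connected_diagram F" "connected_diagram (C - F)"
proof -
  define r where "r = root_chord C"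
  define e where "e = Max r"
  have ne: "C \<noteq> {}" using C(3) by (simp add: connected_diagram_def)
  have MinU: "Min (\<Union>C) = 1" unfolding C(2) using n by (intro Min_eqI) auto
  have r: "r \<in> C" "1 \<in> r" using root_chord_in[OF C(1) ne] MinU by (auto simp: r_def)
  have Minr: "Min r = 1" using Min_root_chord[OF C(1) ne] MinU by (simp add: r_def)
  have re: "r = {1, e}" "1 < e" using chord_Min_Max[OF C(1) r(1)] Minr by (auto simp: e_def)
  have "card C = n" using card_Union_chord_set[OF C(1)] C(2) by simp
  then have ner: "C - {root_chord C} \<noteq> {}"
  proof -
    have "C \<noteq> {r}" using \<open>card C = n\<close> n by auto
    then show ?thesis using r(1) by (auto simp: r_def)
  qed
  note F = first_component_subset[OF C(1) ner, folded r_def F_def]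
    connected_first_component[OF C(1) ner, folded F_def]
    Min_in_first_component[OF C(1) ner, folded r_def F_def]
    first_component_no_crossing[OF C(1) ner, folded r_def F_def]
  define S where "S = \<Union>F"
  have csF: "chord_set F" using F(1) by (intro chord_set_mono[OF C(1)]) blast
  have in_S_iff: "x \<in> S \<longleftrightarrow> c \<in> F" if "c \<in> C" "x \<in> c" for x c
    using chord_set_eq[OF C(1) that(1)] that F(1) unfolding S_def by blast
  have S1: "1 \<notin> S" "e \<notin> S" using in_S_iff[OF r(1)] re F(1) by auto
  have Ssub: "S \<subseteq> {1..2 * n}" unfolding S_def using C(2) F(1) by blast
  \<comment> \<open>Connectedness forces a crossing out of \<open>F\<close>, and by maximality of
    the component it can only meet the root.\<close>
  obtain f where f: "f \<in> F" "crosses f r"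
  proof -
    have "F \<noteq> C" using F(1) r by blast
    moreover have "F \<noteq> {}" using F(2) by (simp add: connected_diagram_def)
    ultimately obtain x y where "x \<in> F" "y \<in> C - F" "crosses x y"
      using connected_diagramD[OF C(3), of F] F(1) by blast
    then show ?thesis using that F(4)[of x y] by blast
  qed
  have fS: "Min f \<in> S" "Max f \<in> S" using Min_Max_in_Union[OF csF f(1)] by (auto simp: S_def)
  have f2: "1 < Min f" "Min f < e" "e < Max f"
    using f(2) Minr S1 fS Ssub by (auto simp: crosses_def e_def)
  have e2: "e \<noteq> 2" using f2 by auto
  have S2: "2 \<in> S"
  proof -
    have "2 \<in> \<Union>C" using C(2) n by auto
    then obtain c where c: "c \<in> C" "2 \<in> c" by blast
    then have "c \<noteq> r" using re e2 by auto
    have "Min (\<Union>(C - {r})) = 2"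
    proof (rule Min_eqI)
      show "finite (\<Union>(C - {r}))"
        by (rule chord_set_finite_Union[OF chord_set_mono[OF C(1)]]) blast
      show "2 \<in> \<Union>(C - {r})" using c \<open>c \<noteq> r\<close> by blast
      fix y assume "y \<in> \<Union>(C - {r})"
      then obtain d where d: "d \<in> C" "d \<noteq> r" "y \<in> d" by blast
      then have "y \<noteq> 1" using chord_set_eq[OF C(1) d(1) _ _ r(2)] r(1) by blast
      moreover have "y \<in> {1..2 * n}" using d C(2) by blast
      ultimately show "2 \<le> y" by auto
    qed
    then show ?thesis using F(3) by (simp add: S_def)
  qed
  \<comment> \<open>A chord of \<open>F\<close> lies beside, over or under \<open>d\<close>. Those
    not under \<open>d\<close> form a cut of \<open>F\<close> containing the chord at 2, so none
    lies under \<open>d\<close>.\<close>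
  have out: "S \<inter> {Min d..Max d} = {}" if d: "d \<in> C" "d \<notin> F" "d \<noteq> r" for d
  proof -
    note dd = chord_Min_Max[OF C(1) d(1)]
    have dS: "Min d \<notin> S" "Max d \<notin> S" using in_S_iff[OF d(1)] dd(1) d(2) by blast+
    have d1: "Min d > 2"
      using Min_root_chord_less[OF C(1) d(1)] d(3) dS S2 Minr by (cases "Min d = 2") (auto simp: r_def)
    obtain g where g: "g \<in> F" "2 \<in> g" using S2 by (auto simp: S_def)
    have g2: "Min g = 2 \<or> Max g = 2" using chord_endpoint[OF csF g] by auto
    have side: "Max c < Min d \<or> Max d < Min c \<or> Min c < Min d \<and> Max d < Max c
        \<or> Min d < Min c \<and> Max c < Max d" if c: "c \<in> F" for c
    proof -
      have "Min c \<in> S" "Max c \<in> S" using Min_Max_in_Union[OF csF c] by (auto simp: S_def)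
      moreover have "\<not> crosses c d" using F(4)[OF c] d by blast
      moreover have "Min c < Max c" using chord_Min_Max(2)[OF csF c] .
      ultimately have "Min c \<noteq> Min d" "Min c \<noteq> Max d" "Max c \<noteq> Min d" "Max c \<noteq> Max d"
        "\<not> crosses c d" "Min c < Max c"
        using dS by metis+
      then show ?thesis using dd(2) unfolding crosses_def by (smt (verit) linorder_neqE_nat)
    qed
    let ?X = "{c \<in> F. \<not> (Min d < Min c \<and> Max c < Max d)}"
    have "?X = F"
    proof (rule connected_diagramD[OF F(2)])
      have "g \<in> ?X" using g g2 d1 chord_Min_Max(2)[OF csF g(1)] by auto
      then show "?X \<noteq> {}" by blast
      fix x y assume "x \<in> ?X" "y \<in> F - ?X"
      then show "\<not> crosses x y"
        using side[of x] side[of y] by (auto simp: crosses_def)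
    qed blast
    then have side': "Max c < Min d \<or> Max d < Min c \<or> Min c < Min d \<and> Max d < Max c" if "c \<in> F" for c
      using side[OF that] that by blast
    show ?thesis
    proof (rule ccontr)
      assume "\<not> ?thesis"
      then obtain x where "x \<in> {Min d..Max d}" "x \<in> S" by blast
      then obtain c where x: "x \<in> {Min d..Max d}" "c \<in> F" "x \<in> c" unfolding S_def by blast
      then have "x = Min c \<or> x = Max c" using chord_endpoint[OF csF] by blast
      then show False using side'[OF x(2)] x(1) chord_Min_Max(2)[OF csF x(2)] by auto
    qed
  qed
  \<comment> \<open>The property that spreads from the root along crossings outside
    \<open>F\<close>: nothing of \<open>S\<close> separates the chord from \<open>e\<close>.\<close>
  let ?P = "\<lambda>d. S \<inter> {min e (Min d)..max e (Max d)} = {}"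
  have "{d \<in> C. d \<in> F \<or> d = r \<or> ?P d} = C"
  proof (rule connected_diagramD[OF C(3)])
    fix x y assume x: "x \<in> {d \<in> C. d \<in> F \<or> d = r \<or> ?P d}"
      and y: "y \<in> C - {d \<in> C. d \<in> F \<or> d = r \<or> ?P d}"
    from y have y': "y \<in> C" "y \<notin> F" "y \<noteq> r" "\<not> ?P y" by auto
    note oy = out[OF y'(1-3)]
    show "\<not> crosses x y"
    proof
      assume xy: "crosses x y"
      then consider "x = r" | "x \<noteq> r" "?P x" using x F(4)[of x y] y' by blast
      then show False
      proof cases
        \<comment> \<open>Here \<open>y\<close> crosses the root, so \<open>e\<close> already lies
          between the ends of \<open>y\<close> and the hull is the span of \<open>y\<close>.\<close>
        case 1
        moreover have "Min r < Min y"
          using Min_root_chord_less[OF C(1) y'(1)] y'(3) by (simp add: r_def)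
        ultimately have "Min y < e" "e < Max y" using xy by (auto simp: crosses_def e_def)
        then have "{min e (Min y)..max e (Max y)} = {Min y..Max y}" by simp
        then show False using oy y'(4) by metis
      next
        case 2
        have "{min e (Min y)..max e (Max y)} \<subseteq> {min e (Min x)..max e (Max x)} \<union> {Min y..Max y}"
          using xy by (intro interval_hull_overlap) (auto simp: crosses_def)
        then show False using oy y'(4) 2(2) by blast
      qed
    qed
  qed (use r in auto)
  then have P: "?P d" if "d \<in> C" "d \<notin> F" "d \<noteq> r" for d using that by blast
  have Pt: "S \<inter> {min e t..max e t} = {}" if t: "t \<in> {2..2 * n} - S" for t
  proof -
    have "t \<in> \<Union>C" using t C(2) by auto
    then obtain d where d: "d \<in> C" "t \<in> d" by blast
    show ?thesis
    proof (cases "d = r")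
      case True
      then have "t = e" using d t re by auto
      then show ?thesis using S1 by auto
    next
      case False
      have "d \<notin> F" using in_S_iff[OF d] t by blast
      have "t = Min d \<or> t = Max d" by (rule chord_endpoint[OF C(1) d])
      then have "Min d \<le> t" "t \<le> Max d" using chord_Min_Max(2)[OF C(1) d(1)] by auto
      then have "{min e t..max e t} \<subseteq> {min e (Min d)..max e (Max d)}"
        by (intro atLeastatMost_subset_iff[THEN iffD2] disjI2 conjI min.mono max.mono) simp_all
      then show ?thesis using P[OF d(1) \<open>d \<notin> F\<close> False] by blast
    qed
  qed
  define T where "T = {2..2 * n} - S"
  have eT: "e \<in> T" using re S1 r C(2) by (auto simp: T_def)
  have finT: "finite T" by (simp add: T_def)
  have T: "T = {Min T..Max T}"
  proof (rule interval_eqI[OF finT])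
    show "T \<noteq> {}" using eT by blast
    fix x y z assume xyz: "x \<in> T" "z \<in> T" "x \<le> y" "y \<le> z"
    \<comment> \<open>According to its side of \<open>e\<close>, the point \<open>y\<close> lies
      between \<open>x\<close> and \<open>e\<close> or between \<open>e\<close> and
      \<open>z\<close>.\<close>
    then have "y \<in> {min e x..max e x} \<or> y \<in> {min e z..max e z}"
      by (simp add: min_le_iff_disj le_max_iff_disj) linarith
    then have "y \<notin> S" using Pt[of x] Pt[of z] xyz(1,2) unfolding T_def by blast
    then show "y \<in> T" using xyz by (auto simp: T_def)
  qed
  define a where "a = Min T"
  define b where "b = Max T"
  have Tab: "T = {a..b}" using T by (simp add: a_def b_def)
  have ab: "a \<in> T" "b \<in> T" unfolding a_def b_def using eT by (auto intro!: Min_in Max_in finT)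
  have a3: "3 \<le> a"
  proof -
    have "a \<noteq> 2" using ab(1) S2 unfolding T_def by blast
    moreover have "2 \<le> a" using ab(1) unfolding T_def by simp
    ultimately show ?thesis by simp
  qed
  have b2: "b < 2 * n"
  proof -
    have "Max f \<notin> T" using fS by (simp add: T_def)
    moreover have "a \<le> e" "e \<le> b" using eT unfolding Tab by simp_all
    ultimately have "b < Max f" using f2(3) unfolding Tab by simp
    moreover have "Max f \<in> {1..2 * n}" using Ssub fS(2) by blast
    ultimately show ?thesis by simp
  qed
  have ST: "S = {2..2 * n} - T"
  proof -
    have "{2..2 * n} = {1..2 * n} - {1}" by auto
    then have "S \<subseteq> {2..2 * n}" using Ssub S1(1) by blast
    then show ?thesis unfolding T_def by blast
  qed
  have UD: "\<Union>(C - F) = insert 1 T"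
  proof -
    have "\<Union>(C - F) = {1..2 * n} - S"
      using in_S_iff C(2) by blast
    moreover have "{1..2 * n} = insert 1 {2..2 * n}" using n by auto
    ultimately show ?thesis using S1(1) by (simp add: T_def insert_Diff_if)
  qed
  \<comment> \<open>Parity: \<open>S\<close> has an even number of points among the
    \<open>2 * n - 1\<close> points other than 1, so the interval \<open>T\<close> has an odd
    number, \<open>2 * j + 1\<close>.\<close>
  have "even (card S)" using card_Union_chord_set[OF csF] by (simp add: S_def)
  moreover have "card S = 2 * n - 1 - (b + 1 - a)"
    unfolding ST Tab using a3 b2 by (subst card_Diff_subset) auto
  moreover have "a \<le> b" using ab(1) unfolding Tab by simp
  then obtain d where d: "b = a + d" using le_Suc_ex by blast
  ultimately have "even (2 * n - (2 + d))" by simp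
  moreover have "2 + d \<le> 2 * n" using d a3 b2 by simp
  ultimately have "even d" by simp
  then obtain j where "d = 2 * j" by blast
  with d have bj: "b = a + 2 * j" by simp
  have conD: "connected_diagram (C - F)"
  proof (rule connected_diagramI)
    show "r \<in> C - F" using r F(1) by blast
    fix X assume X: "X \<subseteq> C - F" "r \<in> X" "\<And>x y. x \<in> X \<Longrightarrow> y \<in> C - F - X \<Longrightarrow> \<not> crosses x y"
    \<comment> \<open>The chords of \<open>F\<close> cross nothing outside \<open>F\<close> except
      \<open>r\<close>, which is in \<open>X\<close>, so adding \<open>F\<close> to the cut of
      \<open>C - F\<close> gives a cut of \<open>C\<close>.\<close>
    have "X \<union> F = C"
    proof (rule connected_diagramD[OF C(3)])
      fix x y assume "x \<in> X \<union> F" "y \<in> C - (X \<union> F)"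
      then show "\<not> crosses x y" using X F(4)[of x y] by blast
    qed (use X F(1) in auto)
    then show "X = C - F" using X(1) by blast
  qed
  show ?thesis
  proof (rule that[of a j])
    show "a + 2 * j < 2 * n" using b2 bj by simp
    show "\<Union>F = {2..2 * n} - {a..a + 2 * j}" using ST unfolding S_def Tab bj .
    show "\<Union>(C - F) = insert 1 {a..a + 2 * j}" using UD unfolding Tab bj .
  qed (rule a3 F(2) conD)+
qed

text \<open>A connected diagram corresponds to its first component with \<open>n - 1 - j\<close>
  chords, a gap in it, and the connected diagram on the \<open>j + 1\<close> chords left. Only the
  first component influences the index, which accounts for the thresholds \<open>t - 1\<close> and
  0.\<close>

lemma card_connected_on_rec:
  assumes n: "2 \<le> n"
  shows "card (connected_on {1..2 * n} t) =
    (\<Sum>j<n - 1. (2 * n - 3 - 2 * j) * card (connected_on {1..2 * (n - 1 - j)} (t - 1))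
      * card (connected_on {1..2 * (j + 1)} 0))"
proof -
  define A where "A = (\<lambda>j a. connected_on ({2..2 * n} - {a..a + 2 * j}) (t - 1))"
  define B where "B = (\<lambda>j a. connected_on (insert 1 {a..a + 2 * j}) 0)"
  define I where "I = (SIGMA j:{..<n - 1}. SIGMA a:{3..<2 * n - 2 * j}. A j a \<times> B j a)"
  define h :: "nat \<times> nat \<times> nat set set \<times> nat set set \<Rightarrow> nat set set"
    where "h = (\<lambda>(j, a, F, D). F \<union> D)"
  note defs = A_def B_def connected_on_def
  have key: "chord_set (F \<union> D)" "\<Union>(F \<union> D) = {1..2 * n}" "connected_diagram (F \<union> D)"
     "F \<inter> D = {}" "first_component (F \<union> D) = F"
     "first_terminal_index (F \<union> D) = Suc (first_terminal_index F)"
    if "(j, a, F, D) \<in> I" for j a F D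
  proof -
    have "3 \<le> a" "a + 2 * j < 2 * n" "chord_set F" "\<Union>F = {2..2 * n} - {a..a + 2 * j}"
      "connected_diagram F" "chord_set D" "\<Union>D = insert 1 {a..a + 2 * j}" "connected_diagram D"
      using that by (auto simp: I_def defs)
    from nested_union[OF this]
    show "chord_set (F \<union> D)" "\<Union>(F \<union> D) = {1..2 * n}" "connected_diagram (F \<union> D)"
     "F \<inter> D = {}" "first_component (F \<union> D) = F"
     "first_terminal_index (F \<union> D) = Suc (first_terminal_index F)" .
  qed
  have "bij_betw h I (connected_on {1..2 * n} t)"
    unfolding bij_betw_def
  proof
    show "inj_on h I"
    proof (rule inj_onI)
      fix u v assume uv: "u \<in> I" "v \<in> I" "h u = h v"
      obtain j a F D where u: "u = (j, a, F, D)" by (cases u)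
      obtain j' a' F' D' where v: "v = (j', a', F', D')" by (cases v)
      note ku = key[OF uv(1)[unfolded u]] and kv = key[OF uv(2)[unfolded v]]
      have eq: "F \<union> D = F' \<union> D'" using uv(3) by (simp add: u v h_def)
      \<comment> \<open>All data are recovered from the union: \<open>F\<close> is its first
        component, \<open>D\<close> is the rest, and the endpoints of \<open>D\<close> other than 1
        form the interval.\<close>
      have FF: "F = F'" using ku(5) kv(5) eq by simp
      then have DD: "D = D'" using ku(4) kv(4) eq by blast
      have aj: "3 \<le> a" "3 \<le> a'" "\<Union>D = insert 1 {a..a + 2 * j}" "\<Union>D' = insert 1 {a'..a' + 2 * j'}"
        using uv(1,2) by (auto simp: u v I_def defs)
      then have "insert 1 {a..a + 2 * j} - {1} = insert 1 {a'..a' + 2 * j'} - {1}" using DD by simp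
      moreover have "1 \<notin> {a..a + 2 * j}" "1 \<notin> {a'..a' + 2 * j'}" using aj by auto
      ultimately have "{a..a + 2 * j} = {a'..a' + 2 * j'}" by simp
      then have "a = a'" "j = j'" by (auto simp: Icc_eq_Icc)
      then show "u = v" using FF DD by (simp add: u v)
    qed
    show "h ` I = connected_on {1..2 * n} t"
    proof (intro equalityI subsetI)
      fix C assume "C \<in> h ` I"
      then obtain j a F D where I: "(j, a, F, D) \<in> I" and C: "C = F \<union> D"
        by (auto simp: h_def)
      have "t - 1 \<le> int (first_terminal_index F)" using I by (auto simp: I_def defs)
      then show "C \<in> connected_on {1..2 * n} t"
        using key[OF I] unfolding C connected_on_def by simp
    next
      fix C assume "C \<in> connected_on {1..2 * n} t"
      then have C: "chord_set C" "\<Union>C = {1..2 * n}" "connected_diagram C"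
        "t \<le> int (first_terminal_index C)" by (auto simp: connected_on_def)
      let ?F = "first_component C"
      obtain a j where aj: "3 \<le> a" "a + 2 * j < 2 * n" "\<Union>?F = {2..2 * n} - {a..a + 2 * j}"
        "\<Union>(C - ?F) = insert 1 {a..a + 2 * j}" "connected_diagram ?F" "connected_diagram (C - ?F)"
        by (rule gap_of_first_component[OF C(1-3) n])
      have sub: "?F \<subseteq> C" unfolding first_component_def by (auto simp: linked_def)
      have cs: "chord_set ?F" "chord_set (C - ?F)"
        using sub by (auto intro: chord_set_mono[OF C(1)])
      have U: "?F \<union> (C - ?F) = C" using sub by blast
      have "first_terminal_index C = Suc (first_terminal_index ?F)"
        using nested_union(6)[OF aj(1,2) cs(1) aj(3,5) cs(2) aj(4,6)] U by simp
      then have "(j, a, ?F, C - ?F) \<in> I"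
        using aj cs C(4) by (auto simp: I_def defs)
      moreover have "C = h (j, a, ?F, C - ?F)" using U by (simp add: h_def)
      ultimately show "C \<in> h ` I" by blast
    qed
  qed
  then have "card (connected_on {1..2 * n} t) = card I" by (simp add: bij_betw_same_card)
  also have "\<dots> = (\<Sum>j<n - 1. \<Sum>a\<in>{3..<2 * n - 2 * j}. card (A j a) * card (B j a))"
  proof -
    have fin: "finite (A j a)" "finite (B j a)" for j a
      by (simp_all add: A_def B_def finite_connected_on)
    have "card (SIGMA a:{3..<2 * n - 2 * j}. A j a \<times> B j a) =
        (\<Sum>a\<in>{3..<2 * n - 2 * j}. card (A j a) * card (B j a))" for j
      by (subst card_SigmaI) (simp_all add: fin card_cartesian_product)
    then show ?thesis unfolding I_def by (subst card_SigmaI) (simp_all add: fin finite_SigmaI)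
  qed
  also have "\<dots> = (\<Sum>j<n - 1. \<Sum>a\<in>{3..<2 * n - 2 * j}. card (connected_on {1..2 * (n - 1 - j)} (t - 1))
      * card (connected_on {1..2 * (j + 1)} 0))"
    unfolding A_def B_def
    by (intro sum.cong refl arg_cong2[of _ _ _ _ "(*)"] card_connected_on_gap card_connected_on_insert) auto
  \<comment> \<open>The summand does not depend on \<open>a\<close>, whose
    \<open>2 * n - 3 - 2 * j\<close> values are the inner gaps of a diagram with
    \<open>n - 1 - j\<close> chords.\<close>
  also have "\<dots> = (\<Sum>j<n - 1. (2 * n - 3 - 2 * j) * card (connected_on {1..2 * (n - 1 - j)} (t - 1))
      * card (connected_on {1..2 * (j + 1)} 0))"
    by (intro sum.cong refl) (simp add: algebra_simps)
  finally show ?thesis .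
qed

lemma card_connected_on_zero:
  assumes "int m < t"
  shows "card (connected_on {1..2 * m} t) = 0"
proof -
  have "connected_on {1..2 * m} t = {}"
  proof (rule ccontr)
    assume "\<not> ?thesis"
    then obtain C where C: "chord_set C" "\<Union>C = {1..2 * m}" "connected_diagram C"
        "t \<le> int (first_terminal_index C)" by (auto simp: connected_on_def)
    have "card C = m" using card_Union_chord_set[OF C(1)] C(2) by simp
    then show False using first_terminal_index_le_card[OF C(1,3)] C(4) assms by simp
  qed
  then show ?thesis by simp
qed

text \<open>The lowered threshold is \<open>n - k - 1 = (n - 1 - j) - (k - j)\<close>, and for
  \<open>j > k\<close> it exceeds the number of chords of the first component. Taking both arguments
  equal in \<open>num_diagrams (j + 1) (j + 1)\<close> makes its threshold 0, so it counts all
  connected diagrams with \<open>j + 1\<close> chords.\<close>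

lemma num_diagrams_rec:
  assumes "k + 2 \<le> n"
  shows "num_diagrams n k = (\<Sum>j\<le>k. (2 * n - 3 - 2 * j) * num_diagrams (n - 1 - j) (k - j)
      * num_diagrams (j + 1) (j + 1))"
proof -
  have "num_diagrams n k = (\<Sum>j<n - 1. (2 * n - 3 - 2 * j) *
      card (connected_on {1..2 * (n - 1 - j)} (int n - int k - 1)) * card (connected_on {1..2 * (j + 1)} 0))"
    using assms unfolding num_diagrams_eq by (intro card_connected_on_rec) simp
  also have "\<dots> = (\<Sum>j\<le>k. (2 * n - 3 - 2 * j) *
      card (connected_on {1..2 * (n - 1 - j)} (int n - int k - 1)) * card (connected_on {1..2 * (j + 1)} 0))"
  proof (rule sum.mono_neutral_right)
    show "\<forall>j\<in>{..<n - 1} - {..k}. (2 * n - 3 - 2 * j) *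
      card (connected_on {1..2 * (n - 1 - j)} (int n - int k - 1)) * card (connected_on {1..2 * (j + 1)} 0) = 0"
    proof
      fix j assume "j \<in> {..<n - 1} - {..k}"
      then have "int (n - 1 - j) < int n - int k - 1" by auto
      from card_connected_on_zero[OF this] show "(2 * n - 3 - 2 * j) *
      card (connected_on {1..2 * (n - 1 - j)} (int n - int k - 1)) * card (connected_on {1..2 * (j + 1)} 0) = 0"
        by simp
    qed
  qed (use assms in auto)
  also have "\<dots> = (\<Sum>j\<le>k. (2 * n - 3 - 2 * j) * num_diagrams (n - 1 - j) (k - j)
      * num_diagrams (j + 1) (j + 1))"
    unfolding num_diagrams_eq
  proof (intro sum.cong refl)
    fix j assume "j \<in> {..k}"
    then have "int n - int k - 1 = int (n - 1 - j) - int (k - j)" using assms by auto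
    then show "(2 * n - 3 - 2 * j) * card (connected_on {1..2 * (n - 1 - j)} (int n - int k - 1)) *
         card (connected_on {1..2 * (j + 1)} 0) =
         (2 * n - 3 - 2 * j) * card (connected_on {1..2 * (n - 1 - j)} (int (n - 1 - j) - int (k - j))) *
         card (connected_on {1..2 * (j + 1)} (int (j + 1) - int (j + 1)))" by simp
  qed
  finally show ?thesis .
qed

lemma num_diagrams_1: "num_diagrams 1 k = 1"
proof -
  have cs: "chord_set {{1, 2}}" by (auto simp: chord_set_def)
  have "{C. chord_set C \<and> \<Union>C = {1..2 * 1}} = {{{1, 2}}}"
  proof (intro equalityI subsetI)
    fix C assume "C \<in> {C. chord_set C \<and> \<Union>C = {1..2 * 1}}"
    then have C: "chord_set C" "\<Union>C = {1, 2}" by auto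
    then have "card C = 1" using card_Union_chord_set[OF C(1)] by simp
    then obtain c where "C = {c}" by (auto simp: card_1_singleton_iff)
    then show "C \<in> {{{1, 2}}}" using C(2) by simp
  qed (use cs in auto)
  moreover have "connected_diagram {{1, 2}}"
    by (simp add: connected_diagram_def linked_refl)
  moreover have "int 1 - int k \<le> int (first_terminal_index {{1, 2}})"
    using first_terminal_index_singleton[OF cs] by simp
  moreover have "connected_on {1..2 * 1} (int 1 - int k) = {C. chord_set C \<and> \<Union>C = {1..2 * 1}} \<inter>
      {C. connected_diagram C \<and> int 1 - int k \<le> int (first_terminal_index C)}"
    unfolding connected_on_def by blast
  ultimately have "connected_on {1..2 * 1} (int 1 - int k) = {{{1, 2}}}"
    by simp
  then show ?thesis by (simp add: num_diagrams_eq)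
qed

section \<open>Asymptotics of the recurrence\<close>

text \<open>From some \<open>M\<close> on, the increments of \<open>a\<close> differ from
  \<open>l\<close> times those of \<open>b\<close> by at most \<open>e / 2\<close> times the latter;
  summation preserves this, and \<open>b n\<close> outgrows the boundary terms at
  \<open>M\<close>.\<close>

lemma stolz_cesaro:
  fixes a b :: "nat \<Rightarrow> real"
  assumes b: "filterlim b at_top sequentially"
    and inc: "eventually (\<lambda>n. b n < b (Suc n)) sequentially"
    and lim: "(\<lambda>n. (a (Suc n) - a n) / (b (Suc n) - b n)) \<longlonglongrightarrow> l"
  shows "(\<lambda>n. a n / b n) \<longlonglongrightarrow> l"
proof (rule tendstoI)
  fix e :: real assume e: "e > 0"
  have "eventually (\<lambda>n. dist ((a (Suc n) - a n) / (b (Suc n) - b n)) l < e / 2) sequentially"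
    using lim e by (intro tendstoD) auto
  with inc have "eventually (\<lambda>n. \<bar>a (Suc n) - a n - l * (b (Suc n) - b n)\<bar> \<le> e / 2 * (b (Suc n) - b n)) sequentially"
  proof eventually_elim
    case (elim n)
    let ?d = "b (Suc n) - b n"
    have d: "?d > 0" using elim by simp
    have "\<bar>a (Suc n) - a n - l * ?d\<bar> = \<bar>(a (Suc n) - a n) / ?d - l\<bar> * ?d"
      using d by (simp add: field_simps abs_mult flip: abs_mult_pos)
    also have "\<dots> \<le> e / 2 * ?d"
      using elim(2) d by (intro mult_right_mono) (auto simp: dist_real_def)
    finally show ?case .
  qed
  then obtain M where M: "\<And>n. n \<ge> M \<Longrightarrow> \<bar>a (Suc n) - a n - l * (b (Suc n) - b n)\<bar> \<le> e / 2 * (b (Suc n) - b n)"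
    by (auto simp: eventually_sequentially)
  have tel: "\<bar>a n - a M - l * (b n - b M)\<bar> \<le> e / 2 * (b n - b M)" if "n \<ge> M" for n
    using that
  proof (induction n rule: dec_induct)
    case base
    show ?case by simp
  next
    case (step n)
    have "a (Suc n) - a M - l * (b (Suc n) - b M) =
        (a n - a M - l * (b n - b M)) + (a (Suc n) - a n - l * (b (Suc n) - b n))"
      by (simp add: algebra_simps)
    moreover have "e / 2 * (b (Suc n) - b M) = e / 2 * (b n - b M) + e / 2 * (b (Suc n) - b n)"
      by (simp flip: distrib_left)
    ultimately show ?case using step.IH M[OF step.hyps(1)] by linarith
  qed
  \<comment> \<open>Bounds the boundary terms at \<open>M\<close>; once
    \<open>b n > 4 * K / e\<close> they cost less than the remaining
    \<open>e / 2 * b n\<close>.\<close>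
  define K where "K = \<bar>a M - l * b M\<bar> + e / 2 * \<bar>b M\<bar>"
  have "eventually (\<lambda>n. b n > max 1 (4 * K / e)) sequentially"
    using b unfolding filterlim_at_top_dense by blast
  moreover have "eventually (\<lambda>n. n \<ge> M) sequentially" by (rule eventually_ge_at_top)
  ultimately show "eventually (\<lambda>n. dist (a n / b n) l < e) sequentially"
  proof eventually_elim
    case (elim n)
    have bn: "b n > 0" "4 * K < e * b n" using elim(1) e by (auto simp: field_simps)
    have "a n - l * b n = (a n - a M - l * (b n - b M)) + (a M - l * b M)"
      by (simp add: algebra_simps)
    then have "\<bar>a n - l * b n\<bar> \<le> e / 2 * (b n - b M) + \<bar>a M - l * b M\<bar>"
      using tel[OF elim(2)] by linarith
    also have "\<dots> \<le> e / 2 * b n + K"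
    proof -
      have "- (e / 2 * b M) \<le> e / 2 * \<bar>b M\<bar>" using e by (simp add: abs_if)
      then show ?thesis by (simp add: K_def algebra_simps)
    qed
    also have "\<dots> < e * b n" using bn(2) mult_pos_pos[OF e bn(1)] by (simp add: field_simps)
    finally have "\<bar>a n - l * b n\<bar> < e * b n" .
    moreover have "a n / b n - l = (a n - l * b n) / b n"
      using bn by (simp add: field_simps)
    then have "\<bar>a n / b n - l\<bar> = \<bar>a n - l * b n\<bar> / b n"
      using bn by (simp add: abs_divide)
    ultimately show ?case using bn by (simp add: dist_real_def field_simps)
  qed
qed

text \<open>Factoring the difference of powers leaves \<open>k\<close> summands that each tend to 1,
  and \<open>n * (ln (n + 1) - ln n)\<close> tends to 1 as well. For \<open>k = 0\<close> both sides
  vanish, so the truncated exponent does no harm.\<close>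

lemma ln_power_diff_asymp:
  "(\<lambda>n. real n * (ln (real (Suc n)) ^ k - ln (real n) ^ k) / ln (real n) ^ (k - 1)) \<longlonglongrightarrow> real k"
proof (cases k)
  case (Suc m)
  have "(\<lambda>n. real n * (ln (real (Suc n)) - ln (real n)) *
      (\<Sum>p<Suc m. (ln (real (Suc n)) / ln (real n)) ^ p)) \<longlonglongrightarrow> 1 * (\<Sum>p<Suc m. 1 ^ p)"
  proof (intro tendsto_mult tendsto_sum tendsto_power)
    show "(\<lambda>n. real n * (ln (real (Suc n)) - ln (real n))) \<longlonglongrightarrow> 1" by real_asymp
    show "(\<lambda>n. ln (real (Suc n)) / ln (real n)) \<longlonglongrightarrow> 1" by real_asymp
  qed
  moreover have "eventually (\<lambda>n. real n * (ln (real (Suc n)) - ln (real n)) *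
      (\<Sum>p<Suc m. (ln (real (Suc n)) / ln (real n)) ^ p) =
      real n * (ln (real (Suc n)) ^ k - ln (real n) ^ k) / ln (real n) ^ (k - 1)) sequentially"
    using eventually_gt_at_top[of 1]
  proof eventually_elim
    case (elim n)
    define x where "x = ln (real (Suc n))"
    define y where "y = ln (real n)"
    have y: "y \<noteq> 0" using elim by (simp add: y_def)
    have "x ^ Suc m - y ^ Suc m = (x - y) * (\<Sum>p<Suc m. x ^ p * y ^ (m - p))"
      by (rule diff_power_eq_sum)
    also have "(\<Sum>p<Suc m. x ^ p * y ^ (m - p)) = (\<Sum>p<Suc m. (x / y) ^ p * y ^ m)"
      using y by (intro sum.cong refl) (simp add: power_divide power_diff less_Suc_eq_le)
    also have "\<dots> = (\<Sum>p<Suc m. (x / y) ^ p) * y ^ m" by (rule sum_distrib_right[symmetric])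
    finally show ?case using y by (simp only: Suc flip: x_def y_def) simp
  qed
  ultimately show ?thesis using Suc by (auto intro: Lim_transform_eventually)
qed auto

text \<open>The double factorial \<open>(2 n - 3)!!\<close>, with value 1 at \<open>n = 0\<close>
  and \<open>n = 1\<close>. The form with \<open>pochhammer\<close> connects it to the product
  formula for the Gamma function.\<close>

definition odd_fact :: "nat \<Rightarrow> real" where
  "odd_fact n = 2 ^ (n - 1) * pochhammer (1 / 2) (n - 1)"

lemma odd_fact_Suc: "1 \<le> n \<Longrightarrow> odd_fact (Suc n) = (2 * real n - 1) * odd_fact n"
  by (cases n) (simp_all add: odd_fact_def pochhammer_Suc algebra_simps)

lemma odd_fact_pos: "odd_fact n > 0"
  by (simp add: odd_fact_def pochhammer_pos)

text \<open>The limit formula for the Gamma function at \<open>1 / 2\<close>, with value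
  \<open>sqrt pi\<close>, read as an asymptotic formula for
  \<open>pochhammer (1 / 2)\<close>.\<close>

lemma odd_fact_asymp:
  "(\<lambda>n. odd_fact n * (2 * sqrt pi) * real n powr (3 / 2) / (2 ^ n * fact n)) \<longlonglongrightarrow> 1"
proof -
  have "Gamma_series' (1 / 2 :: real) \<longlonglongrightarrow> sqrt pi"
    using Gamma_series'_LIMSEQ[of "1 / 2 :: real"] by (simp add: Gamma_one_half_real)
  \<comment> \<open>The series contains one factor too many, \<open>n - 1 / 2\<close>; the
    correction, which tends to 1, replaces it by \<open>n\<close>.\<close>
  then have "(\<lambda>n. sqrt pi / Gamma_series' (1 / 2) n * (real n / (real n - 1 / 2))) \<longlonglongrightarrow> sqrt pi / sqrt pi * 1"
    by (intro tendsto_mult tendsto_divide tendsto_const) (auto, real_asymp)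
  moreover have "eventually (\<lambda>n. sqrt pi / Gamma_series' (1 / 2) n * (real n / (real n - 1 / 2)) =
      odd_fact n * (2 * sqrt pi) * real n powr (3 / 2) / (2 ^ n * fact n)) sequentially"
    using eventually_gt_at_top[of 0]
  proof eventually_elim
    case (elim n)
    then obtain m where n: "n = Suc m" by (cases n) auto
    have P: "pochhammer (1 / 2) m > (0 :: real)" by (simp add: pochhammer_pos)
    have e: "exp (1 / 2 * ln (real n)) = real n powr (1 / 2)" using elim by (simp add: powr_def)
    have pp: "real n powr (3 / 2) = real n * real n powr (1 / 2)"
      using elim powr_add[of "real n" 1 "1 / 2"] by simp
    define q where "q = real n powr (1 / 2)"
    have q: "q > 0" "q * q = real n" using elim powr_add[of "real n" "1 / 2" "1 / 2"] by (auto simp: q_def)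
    have G: "Gamma_series' (1 / 2) n = fact m * q / (pochhammer (1 / 2) m * (real n - 1 / 2))"
      using e by (simp add: Gamma_series'_def n pochhammer_Suc q_def algebra_simps)
    have h: "real n - 1 / 2 > 0" using n by simp
    have "sqrt pi / Gamma_series' (1 / 2) n * (real n / (real n - 1 / 2)) =
        sqrt pi * pochhammer (1 / 2) m * real n / (fact m * q)"
      unfolding G using h P q by (simp add: divide_simps)
    also have "\<dots> = sqrt pi * pochhammer (1 / 2) m * q / fact m"
      using q by (simp add: divide_simps flip: q(2))
    also have "\<dots> = odd_fact n * (2 * sqrt pi) * real n powr (3 / 2) / (2 ^ n * fact n)"
    proof -
      have "odd_fact n = 2 ^ m * pochhammer (1 / 2) m" "(fact n :: real) = real n * fact m" "(2::real) ^ n = 2 * 2 ^ m"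
        by (simp_all add: odd_fact_def n)
      then show ?thesis unfolding pp q_def[symmetric] using elim by (simp add: divide_simps)
    qed
    finally show ?case .
  qed
  ultimately show ?thesis by (auto intro: Lim_transform_eventually)
qed

text \<open>Each unit of \<open>j\<close> divides by one more factor linear in \<open>n\<close>, so
  only \<open>j = 0\<close> gives a ratio of order \<open>1 / n\<close>.\<close>

lemma odd_fact_ratio:
  "(\<lambda>n. real n * (odd_fact (Suc n - Suc j) / odd_fact (Suc n))) \<longlonglongrightarrow> (if j = 0 then 1 / 2 else 0)"
proof (induction j)
  case 0
  have "(\<lambda>n. real n / (2 * real n - 1)) \<longlonglongrightarrow> 1 / 2" by real_asymp
  moreover have "eventually (\<lambda>n. real n / (2 * real n - 1) =
      real n * (odd_fact (Suc n - Suc 0) / odd_fact (Suc n))) sequentially"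
    using eventually_ge_at_top[of 1]
    by eventually_elim (use odd_fact_pos in \<open>simp add: odd_fact_Suc less_imp_neq[symmetric]\<close>)
  ultimately show ?case by (auto intro: Lim_transform_eventually)
next
  case (Suc j)
  have "(\<lambda>n. 1 / (2 * (real n - real j - 1) - 1)) \<longlonglongrightarrow> 0" by real_asymp
  from tendsto_mult[OF Suc.IH this]
  have "(\<lambda>n. real n * (odd_fact (Suc n - Suc j) / odd_fact (Suc n)) * (1 / (2 * (real n - real j - 1) - 1)))
      \<longlonglongrightarrow> 0" by simp
  moreover have "eventually (\<lambda>n. real n * (odd_fact (Suc n - Suc j) / odd_fact (Suc n)) *
      (1 / (2 * (real n - real j - 1) - 1)) =
      real n * (odd_fact (Suc n - Suc (Suc j)) / odd_fact (Suc n))) sequentially"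
    using eventually_gt_at_top[of "Suc j"]
  proof eventually_elim
    case (elim n)
    define m where "m = n - Suc j"
    have m: "1 \<le> m" "Suc n - Suc j = Suc m" "Suc n - Suc (Suc j) = m" "real n - real j - 1 = real m"
      using elim by (auto simp: m_def)
    have "2 * real m - 1 > 0" using m by simp
    then show ?case using odd_fact_pos[of m] unfolding m odd_fact_Suc[OF m(1)] by simp
  qed
  ultimately show ?case by (auto intro: Lim_transform_eventually)
qed

text \<open>Divided by \<open>(2n - 3)!!\<close>, the recurrence expresses the increments of \<open>v k\<close> through
  \<open>v i\<close> with \<open>i < k\<close>; the dominant increment is \<open>v (k - 1) / (2 n)\<close>, whose sum produces the factor
  \<open>ln n / (2 k)\<close>.\<close>

lemma recurrence_limit:
  fixes v :: "nat \<Rightarrow> nat \<Rightarrow> real" and c :: "nat \<Rightarrow> real"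
  assumes v0: "\<And>n. 1 \<le> n \<Longrightarrow> v 0 n = 1" and c1: "c 1 = 1"
    and rec: "\<And>n k. k < n \<Longrightarrow> v k (Suc n) - v k n =
      (\<Sum>j=1..k. c j * (odd_fact (Suc n - j) / odd_fact (Suc n)) * v (k - j) (n - j))"
  shows "(\<lambda>n. v k n / ln (real n) ^ k) \<longlonglongrightarrow> 1 / (2 ^ k * fact k)"
proof (induction k rule: less_induct)
  case (less k)
  show ?case
  proof (cases k)
    case 0
    have "eventually (\<lambda>n. 1 = v k n / ln (real n) ^ k) sequentially"
      using eventually_ge_at_top[of 1] by eventually_elim (simp add: 0 v0)
    then show ?thesis using 0 by (auto intro: Lim_transform_eventually)
  next
    case (Suc i)
    define R where "R = (\<lambda>j n. odd_fact (Suc n - j) / odd_fact (Suc n))"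
    \<comment> \<open>By induction \<open>v (k - j) (n - j)\<close> has order
      \<open>ln (real n) ^ (k - j)\<close>; the further division by
      \<open>ln (real n) ^ (j - 1)\<close> gives limit 0 unless \<open>j = 1\<close>.\<close>
    have shifted: "(\<lambda>n. v (k - j) (n - j) / ln (real n) ^ i) \<longlonglongrightarrow>
        1 / (2 ^ (k - j) * fact (k - j)) * (if j = 1 then 1 else 0)"
      if j: "j \<in> {1..k}" for j
    proof -
      have "(\<lambda>n. v (k - j) (n - j) / ln (real (n - j)) ^ (k - j)) \<longlonglongrightarrow> 1 / (2 ^ (k - j) * fact (k - j))"
        using less.IH[of "k - j"] j
        by (intro filterlim_compose[OF _ filterlim_minus_const_nat_at_top]) auto
      moreover have "(\<lambda>n. (ln (real n - real j) / ln (real n)) ^ (k - j)) \<longlonglongrightarrow> 1 ^ (k - j)"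
        by (intro tendsto_power) real_asymp
      moreover have "(\<lambda>n. (1 / ln (real n)) ^ (j - 1)) \<longlonglongrightarrow> (if j = 1 then 1 else 0)"
      proof (cases "j = 1")
        case False
        have "(\<lambda>n. 1 / ln (real n)) \<longlonglongrightarrow> 0" by real_asymp
        then have "(\<lambda>n. (1 / ln (real n)) ^ (j - 1)) \<longlonglongrightarrow> 0 ^ (j - 1)" by (rule tendsto_power)
        then show ?thesis using False j by (simp add: power_0_left)
      qed simp
      ultimately have "(\<lambda>n. v (k - j) (n - j) / ln (real (n - j)) ^ (k - j) *
          (ln (real n - real j) / ln (real n)) ^ (k - j) * (1 / ln (real n)) ^ (j - 1)) \<longlonglongrightarrow>
          1 / (2 ^ (k - j) * fact (k - j)) * 1 ^ (k - j) * (if j = 1 then 1 else 0)"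
        by (intro tendsto_mult)
      moreover have "eventually (\<lambda>n. v (k - j) (n - j) / ln (real (n - j)) ^ (k - j) *
          (ln (real n - real j) / ln (real n)) ^ (k - j) * (1 / ln (real n)) ^ (j - 1) =
          v (k - j) (n - j) / ln (real n) ^ i) sequentially"
        using eventually_gt_at_top[of "j + 1"]
      proof eventually_elim
        case (elim n)
        have r: "real n - real j = real (n - j)" using elim by simp
        have nz: "ln (real (n - j)) \<noteq> 0" "ln (real n) \<noteq> 0" using elim by auto
        have "i = (k - j) + (j - 1)" using j Suc by auto
        then show ?case unfolding r using nz by (simp add: power_add power_divide)
      qed
      ultimately show ?thesis by (auto intro: Lim_transform_eventually)
    qed
    have ratio: "(\<lambda>n. real n * R j n) \<longlonglongrightarrow> (if j = 1 then 1 / 2 else 0)" if "j \<in> {1..k}" for j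
      using odd_fact_ratio[of "j - 1"] that by (cases j) (auto simp: R_def)
    have "(\<lambda>n. \<Sum>j=1..k. c j * (real n * R j n) * (v (k - j) (n - j) / ln (real n) ^ i)) \<longlonglongrightarrow>
        (\<Sum>j=1..k. c j * (if j = 1 then 1 / 2 else 0) *
          (1 / (2 ^ (k - j) * fact (k - j)) * (if j = 1 then 1 else 0)))"
      by (intro tendsto_sum tendsto_mult tendsto_const shifted ratio)
    also have "(\<Sum>j=1..k. c j * (if j = 1 then 1 / 2 else 0) *
          (1 / (2 ^ (k - j) * fact (k - j)) * (if j = 1 then 1 else 0))) =
        (\<Sum>j=1..k. if j = 1 then c j / 2 * (1 / (2 ^ i * fact i)) else 0)"
      by (intro sum.cong refl) (simp add: Suc)
    also have "\<dots> = 1 / (2 ^ k * fact i)" using Suc c1 by simp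
    finally have num: "(\<lambda>n. \<Sum>j=1..k. c j * (real n * R j n) * (v (k - j) (n - j) / ln (real n) ^ i)) \<longlonglongrightarrow>
        1 / (2 ^ k * fact i)" .
    have den: "(\<lambda>n. real n * (ln (real (Suc n)) ^ k - ln (real n) ^ k) / ln (real n) ^ i) \<longlonglongrightarrow> real k"
      using ln_power_diff_asymp[of k] by (simp add: Suc)
    have "(\<lambda>n. (\<Sum>j=1..k. c j * (real n * R j n) * (v (k - j) (n - j) / ln (real n) ^ i)) /
        (real n * (ln (real (Suc n)) ^ k - ln (real n) ^ k) / ln (real n) ^ i)) \<longlonglongrightarrow>
        1 / (2 ^ k * fact i) / real k"
      by (intro tendsto_divide num den) (simp add: Suc)
    \<comment> \<open>Both sides of the fraction carry the factor
      \<open>real n / ln (real n) ^ i\<close>; cancelling it leaves the quotient of increments for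
      \<open>stolz_cesaro\<close>.\<close>
    moreover have "eventually (\<lambda>n. (\<Sum>j=1..k. c j * (real n * R j n) * (v (k - j) (n - j) / ln (real n) ^ i)) /
        (real n * (ln (real (Suc n)) ^ k - ln (real n) ^ k) / ln (real n) ^ i) =
        (v k (Suc n) - v k n) / (ln (real (Suc n)) ^ k - ln (real n) ^ k)) sequentially"
      using eventually_gt_at_top[of "k + 1"]
    proof eventually_elim
      case (elim n)
      have nz: "ln (real n) ^ i \<noteq> 0" "real n \<noteq> 0" using elim by auto
      have "(\<Sum>j=1..k. c j * (real n * R j n) * (v (k - j) (n - j) / ln (real n) ^ i)) =
          real n / ln (real n) ^ i * (\<Sum>j=1..k. c j * R j n * v (k - j) (n - j))"
        unfolding sum_distrib_left by (intro sum.cong refl) simp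
      also have "(\<Sum>j=1..k. c j * R j n * v (k - j) (n - j)) = v k (Suc n) - v k n"
        unfolding R_def using elim by (intro rec[symmetric]) simp
      finally show ?case using nz by simp
    qed
    ultimately have lim: "(\<lambda>n. (v k (Suc n) - v k n) / (ln (real (Suc n)) ^ k - ln (real n) ^ k)) \<longlonglongrightarrow>
        1 / (2 ^ k * fact i) / real k"
      by (rule Lim_transform_eventually)
    have "(\<lambda>n. v k n / ln (real n) ^ k) \<longlonglongrightarrow> 1 / (2 ^ k * fact i) / real k"
    proof (rule stolz_cesaro[OF _ _ lim])
      have "filterlim (\<lambda>n. ln (real n)) at_top sequentially" by real_asymp
      then show "filterlim (\<lambda>n. ln (real n) ^ k) at_top sequentially"
        by (intro filterlim_pow_at_top) (simp_all add: Suc)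
      show "eventually (\<lambda>n. ln (real n) ^ k < ln (real (Suc n)) ^ k) sequentially"
        using eventually_gt_at_top[of 1]
        by eventually_elim (intro power_strict_mono; simp add: Suc)
    qed
    then show ?thesis by (simp add: Suc mult_ac)
  qed
qed

text \<open>Division by \<open>odd_fact n\<close> turns the term \<open>j = 0\<close> into the
  preceding value, so that the recurrence describes increments as in
  \<open>recurrence_limit\<close>. In the application \<open>c j\<close> counts the connected
  diagrams with \<open>j + 1\<close> chords.\<close>

lemma recurrence_asymp_equiv:
  fixes N :: "nat \<Rightarrow> nat \<Rightarrow> real" and c :: "nat \<Rightarrow> real"
  assumes N1: "N 1 0 = 1" and c: "c 0 = 1" "c 1 = 1"
    and rec: "\<And>n k. k + 2 \<le> n \<Longrightarrow> N n k =
      (\<Sum>j\<le>k. (2 * real n - 3 - 2 * real j) * N (n - 1 - j) (k - j) * c j)"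
  shows "(\<lambda>n. N n k) \<sim>[sequentially] (\<lambda>n. 1 / (sqrt pi * 2 ^ (k + 1) * fact k) *
      (ln (real n) ^ k * 2 ^ n * fact n / real n powr (3 / 2)))"
proof -
  define v where "v = (\<lambda>k n. N n k / odd_fact n)"
  have v_Suc: "v k (Suc n) = (\<Sum>j\<le>k. c j * (odd_fact (Suc n - j) / odd_fact (Suc n)) * v (k - j) (n - j))"
    if "k < n" for k n
  proof -
    have "v k (Suc n) = (\<Sum>j\<le>k. (2 * real (Suc n) - 3 - 2 * real j) * N (n - j) (k - j) * c j) / odd_fact (Suc n)"
      unfolding v_def using that by (subst rec) simp_all
    also have "\<dots> = (\<Sum>j\<le>k. c j * (odd_fact (Suc n - j) / odd_fact (Suc n)) * v (k - j) (n - j))"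
      unfolding sum_divide_distrib
    proof (intro sum.cong refl)
      fix j assume j: "j \<in> {..k}"
      \<comment> \<open>The coefficient becomes \<open>2 * (n - j) - 1\<close>, exactly the factor
        by which \<open>odd_fact\<close> grows from \<open>n - j\<close> to its successor.\<close>
      have m: "Suc n - j = Suc (n - j)" "1 \<le> n - j" "2 * real (Suc n) - 3 - 2 * real j = 2 * real (n - j) - 1"
        using j that by auto
      show "(2 * real (Suc n) - 3 - 2 * real j) * N (n - j) (k - j) * c j / odd_fact (Suc n) =
          c j * (odd_fact (Suc n - j) / odd_fact (Suc n)) * v (k - j) (n - j)"
        unfolding m(1,3) odd_fact_Suc[OF m(2)] v_def using odd_fact_pos[of "n - j"] by simp
    qed
    finally show ?thesis .
  qed
  \<comment> \<open>For \<open>k = 0\<close> only the term \<open>j = 0\<close> is present, so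
    \<open>N n 0\<close> equals \<open>odd_fact n\<close> exactly.\<close>
  have v0: "v 0 n = 1" if "1 \<le> n" for n
    using that
  proof (induction n rule: dec_induct)
    case base
    show ?case using N1 by (simp add: v_def odd_fact_def)
  next
    case (step n)
    then show ?case using odd_fact_pos[of "Suc n"] by (simp add: v_Suc c)
  qed
  have "v k (Suc n) - v k n =
      (\<Sum>j=1..k. c j * (odd_fact (Suc n - j) / odd_fact (Suc n)) * v (k - j) (n - j))" if "k < n" for n k
  proof -
    have "{..k} = insert 0 {1..k}" by auto
    then show ?thesis
      using v_Suc[OF that] odd_fact_pos[of "Suc n"] by (simp add: c less_imp_neq[symmetric])
  qed
  from recurrence_limit[where v = v and c = c, OF v0 c(2) this]
  have lim: "(\<lambda>n. v k n / ln (real n) ^ k) \<longlonglongrightarrow> 1 / (2 ^ k * fact k)" .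
  have "(\<lambda>n. v k n / ln (real n) ^ k * (2 ^ k * fact k) *
      (odd_fact n * (2 * sqrt pi) * real n powr (3 / 2) / (2 ^ n * fact n))) \<longlonglongrightarrow>
      1 / (2 ^ k * fact k) * (2 ^ k * fact k) * 1"
    by (intro tendsto_mult lim odd_fact_asymp tendsto_const)
  then have lim1: "(\<lambda>n. v k n / ln (real n) ^ k * (2 ^ k * fact k) *
      (odd_fact n * (2 * sqrt pi) * real n powr (3 / 2) / (2 ^ n * fact n))) \<longlonglongrightarrow> 1" by simp
  show ?thesis
  proof (rule asymp_equivI', rule Lim_transform_eventually[OF lim1])
    show "eventually (\<lambda>n. v k n / ln (real n) ^ k * (2 ^ k * fact k) *
      (odd_fact n * (2 * sqrt pi) * real n powr (3 / 2) / (2 ^ n * fact n)) =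
      N n k / (1 / (sqrt pi * 2 ^ (k + 1) * fact k) *
        (ln (real n) ^ k * 2 ^ n * fact n / real n powr (3 / 2)))) sequentially"
      using eventually_gt_at_top[of 1]
    proof eventually_elim
      case (elim n)
      have "ln (real n) \<noteq> 0" "odd_fact n \<noteq> 0" "real n powr (3 / 2) \<noteq> 0"
        using elim odd_fact_pos[of n] by auto
      then show ?case by (simp add: v_def divide_simps)
    qed
  qed
qed

theorem theorem3p4:
  fixes k :: nat
  shows "(\<lambda>n. real (num_diagrams n k)) \<sim>[sequentially]
         (\<lambda>n. 1 / (sqrt pi * 2 ^ (k + 1) * fact k) *
              (ln (real n) ^ k * 2 ^ n * fact n / real n powr (3 / 2)))"
proof (rule recurrence_asymp_equiv[where N = "\<lambda>n k. real (num_diagrams n k)"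
      and c = "\<lambda>j. real (num_diagrams (j + 1) (j + 1))"])
  fix n k :: nat assume n: "k + 2 \<le> n"
  have "real (num_diagrams n k) = (\<Sum>j\<le>k. real (2 * n - 3 - 2 * j) *
      real (num_diagrams (n - 1 - j) (k - j)) * real (num_diagrams (j + 1) (j + 1)))"
    by (subst num_diagrams_rec[OF n]) simp
  \<comment> \<open>Since \<open>j \<le> k\<close> and \<open>k + 2 \<le> n\<close>, the subtraction
    on natural numbers is not truncated.\<close>
  also have "\<dots> = (\<Sum>j\<le>k. (2 * real n - 3 - 2 * real j) *
      real (num_diagrams (n - 1 - j) (k - j)) * real (num_diagrams (j + 1) (j + 1)))"
    using n by (intro sum.cong refl) (auto simp: of_nat_diff)
  finally show "real (num_diagrams n k) = (\<Sum>j\<le>k. (2 * real n - 3 - 2 * real j) *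
      real (num_diagrams (n - 1 - j) (k - j)) * real (num_diagrams (j + 1) (j + 1)))" .
next
  \<comment> \<open>For \<open>n = 2\<close> the recurrence has the single term \<open>j = 0\<close>
    with coefficient 1 and two pieces of one chord each.\<close>
  have "num_diagrams 2 2 = 1"
    using card_connected_on_rec[of 2 0] num_diagrams_1[of 2] num_diagrams_1[of 1]
    by (simp add: num_diagrams_eq)
  then show "real (num_diagrams (1 + 1) (1 + 1)) = 1" by (simp only: one_add_one of_nat_1)
qed (simp_all add: num_diagrams_1[unfolded One_nat_def])

end
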